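(* Let the weighting $\mathbf{w}$ be fixed (independent of $\mathbf{m}$). For $\mathbf{m}\in\mathcal{R}_M$ let $\mathbf{y}^{\ast}(\mathbf{m})$ denote the solution of the dual problem $\min_{\mathbf{y}\in\mathbb{R}^M}\Psi(\mathbf{y};\mathbf{m})$ and $\mathbf{f}^{\ast}(\mathbf{m})$ the reconstruction. Then the mappings $$\mathbf{m}\mapsto\mathbf{y}^{\ast}(\mathbf{m}),\qquad \mathbf{m}\mapsto\mathbf{f}^{\ast}(\mathbf{m}),\qquad \mathbf{m}\mapsto\mathbf{m}_{\mathrm{next}}=\mathbf{A}_{\mathrm{next}}\mathbf{f}^{\ast}(\mathbf{m})$$ are real-analytic on $\mathcal{R}_M$, and $$\frac{\partial\mathbf{y}^{\ast}}{\partial\mathbf{m}}=-\mathcal{H}^{-1},\qquad \frac{\partial\mathbf{m}_{\mathrm{next}}}{\partial\mathbf{m}}=\mathcal{B}\mathcal{H}^{-1}.$$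
   Context: Fixed data: integers $d\ge1$, $N$, $M,M'\ge 1$; velocity nodes $\mathbf{v}_1,\ldots,\mathbf{v}_N\in\mathbb{R}^d$; quadrature weights $\Delta v_l>0$; multi-indices $\boldsymbol{\alpha}_1,\ldots,\boldsymbol{\alpha}_M\in\mathbb{N}_0^d$ (constrained moments) and $\boldsymbol{\gamma}_1,\ldots,\boldsymbol{\gamma}_{M'}\in\mathbb{N}_0^d$ (higher-order moments needed for the flux); $\lambda\ge0$. Put $p_k(\mathbf{v})=\prod_i v_i^{\alpha_{k,i}}$, $\mathbf{p}=(p_1,\ldots,p_M)^T$, $q_k(\mathbf{v})=\prod_i v_i^{\gamma_{k,i}}$, $\mathbf{q}=(q_1,\ldots,q_{M'})^T$, $\mathbf{A}_{kl}=\Delta v_l\,p_k(\mathbf{v}_l)$ ($M\times N$), $(\mathbf{A}_{\mathrm{next}})_{kl}=\Delta v_l\,q_k(\mathbf{v}_l)$ ($M'\times N$). Standing assumptions: $\mathbf{A}$, nodes and $\Delta v_l$ are fixed; $N>M$ and $\mathrm{rank}(\mathbf{A})=M$; the zero multi-index is among the $\boldsymbol{\alpha}_k$; $w_l>0$ for all $l$. Realizability cone: $\mathcal{R}_M=\{\mathbf{A}\mathbf{f}:\mathbf{f}\in\mathbb{R}^N,\ f_l>0\ \forall l\}$ (an open subset of $\mathbb{R}^M$). Primal problem: for $\mathbf{m}\in\mathcal{R}_M$, minimize $\sum_l\Delta v_lw_lg_l\log(w_lg_l)+\lambda\sum_l|g_l|$ over $\mathbf{g}\in\mathbb{R}^N$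 with $g_l\ge0$ and $\hat{\mathbf{A}}\mathbf{g}=\mathbf{m}$, where $\hat{\mathbf{A}}_{kl}=\mathbf{A}_{kl}w_l$ and $0\log0=0$; it has a unique solution $\mathbf{g}^{\ast}$, and the reconstruction is $\mathbf{f}^{\ast}(\mathbf{m})$ with $f^{\ast}_l=w_lg^{\ast}_l$. Dual problem: minimize over $\mathbf{y}\in\mathbb{R}^M$ the function $\Psi(\mathbf{y};\mathbf{m})=\mathbf{y}^T\mathbf{m}+\sum_l\Delta v_lz_l(\mathbf{y})$, with $z_l(\mathbf{y})=\exp(-1-(\lambda+(\hat{\mathbf{A}}^T\mathbf{y})_l)\kappa_l)=\exp(-1-\lambda\kappa_l-\mathbf{y}^T\mathbf{p}(\mathbf{v}_l))$ and $\kappa_l=1/(\Delta v_lw_l)$. Primal and dual solutions are related by $f^{\ast}_l=z_l(\mathbf{y}^{\ast})$. Gram matrices at $\mathbf{m}$: $\mathcal{H}=\sum_l\Delta v_lf^{\ast}_l\,\mathbf{p}(\mathbf{v}_l)\mathbf{p}(\mathbf{v}_l)^T$ and $\mathcal{B}=\sum_l\Delta v_lf^{\ast}_l\,\mathbf{q}(\mathbf{v}_l)\mathbf{p}(\mathbf{v}_l)^T$, with $f^{\ast}_l=f^{\ast}_l(\mathbf{m})$; $\mathcal{H}$ is positive definite. *)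

theory Defs
  imports "HOL-Analysis.Analysis"
begin

definition monom_eval :: "nat ^ 'd \<Rightarrow> real ^ 'd \<Rightarrow> real"
  where "monom_eval \<beta> x = (\<Prod>i\<in>UNIV. (x $ i) ^ (\<beta> $ i))"

text \<open>Local representability by an unconditionally convergent power series in several real
  variables. On an open set \<open>S\<close> (the only case used here) it does not matter whether the ball
  is required to lie inside \<open>S\<close>.\<close>

definition real_analytic_on ::
    "(real ^ 'm \<Rightarrow> 'b :: real_normed_vector) \<Rightarrow> (real ^ 'm) set \<Rightarrow> bool"
    (infixl "real'_analytic'_on" 50)
  where "f real_analytic_on S \<longleftrightarrow>
    (\<forall>a\<in>S. \<exists>r>0. \<exists>c :: nat ^ 'm \<Rightarrow> 'b. \<forall>x\<in>ball a r.
       ((\<lambda>\<beta>. monom_eval \<beta> (x - a) *\<^sub>R c \<beta>) has_sum f x) UNIV)"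

text \<open>Throughout, \<open>v l\<close> are the velocity nodes, \<open>dv $ l\<close> the quadrature weights, \<open>w $ l\<close> the
  weighting, \<open>lam\<close> the regularisation parameter, \<open>\<alpha>\<close> the multi-indices of the constrained
  moments and \<open>\<gamma>\<close> those of the higher-order moments. The index types \<open>'d\<close>, \<open>'n\<close>, \<open>'m\<close>, \<open>'k\<close>
  have cardinalities \<open>d\<close>, \<open>N\<close>, \<open>M\<close>, \<open>M'\<close>.\<close>

definition monom_vec :: "('m \<Rightarrow> nat ^ 'd) \<Rightarrow> real ^ 'd \<Rightarrow> real ^ 'm"
  where "monom_vec \<alpha> x = (\<chi> k. monom_eval (\<alpha> k) x)"

definition moment_matrix ::
    "('n \<Rightarrow> real ^ 'd) \<Rightarrow> real ^ 'n \<Rightarrow> ('m \<Rightarrow> nat ^ 'd) \<Rightarrow> real ^ 'n ^ 'm"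
  where "moment_matrix v dv \<alpha> = (\<chi> k l. dv $ l * monom_vec \<alpha> (v l) $ k)"

definition realizable ::
    "('n \<Rightarrow> real ^ 'd) \<Rightarrow> real ^ 'n \<Rightarrow> ('m \<Rightarrow> nat ^ 'd) \<Rightarrow> (real ^ 'm) set"
  where "realizable v dv \<alpha> = {moment_matrix v dv \<alpha> *v f | f. \<forall>l. f $ l > 0}"

definition weighted_moment_matrix ::
    "('n \<Rightarrow> real ^ 'd) \<Rightarrow> real ^ 'n \<Rightarrow> real ^ 'n \<Rightarrow> ('m \<Rightarrow> nat ^ 'd) \<Rightarrow> real ^ 'n ^ 'm"
  where "weighted_moment_matrix v dv w \<alpha> = (\<chi> k l. moment_matrix v dv \<alpha> $ k $ l * w $ l)"

text \<open>The convention \<open>0 log 0 = 0\<close> holds automatically, since \<open>0 * ln 0 = 0\<close>.\<close>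

definition primal_objective :: "real ^ 'n \<Rightarrow> real ^ 'n \<Rightarrow> real \<Rightarrow> real ^ 'n \<Rightarrow> real"
  where "primal_objective dv w lam g =
    (\<Sum>l\<in>UNIV. dv $ l * w $ l * g $ l * ln (w $ l * g $ l)) + lam * (\<Sum>l\<in>UNIV. \<bar>g $ l\<bar>)"

definition primal_feasible ::
    "('n \<Rightarrow> real ^ 'd) \<Rightarrow> real ^ 'n \<Rightarrow> real ^ 'n \<Rightarrow> ('m \<Rightarrow> nat ^ 'd) \<Rightarrow> real ^ 'm \<Rightarrow> real ^ 'n \<Rightarrow> bool"
  where "primal_feasible v dv w \<alpha> m g \<longleftrightarrow>
    (\<forall>l. g $ l \<ge> 0) \<and> weighted_moment_matrix v dv w \<alpha> *v g = m"

definition primal_solution ::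
    "('n \<Rightarrow> real ^ 'd) \<Rightarrow> real ^ 'n \<Rightarrow> real ^ 'n \<Rightarrow> ('m \<Rightarrow> nat ^ 'd) \<Rightarrow> real \<Rightarrow> real ^ 'm \<Rightarrow> real ^ 'n"
  where "primal_solution v dv w \<alpha> lam m =
    arg_min (primal_objective dv w lam) (primal_feasible v dv w \<alpha> m)"

definition reconstruction ::
    "('n \<Rightarrow> real ^ 'd) \<Rightarrow> real ^ 'n \<Rightarrow> real ^ 'n \<Rightarrow> ('m \<Rightarrow> nat ^ 'd) \<Rightarrow> real \<Rightarrow> real ^ 'm \<Rightarrow> real ^ 'n"
  where "reconstruction v dv w \<alpha> lam m = (\<chi> l. w $ l * primal_solution v dv w \<alpha> lam m $ l)"

definition dual_density ::
    "('n \<Rightarrow> real ^ 'd) \<Rightarrow> real ^ 'n \<Rightarrow> real ^ 'n \<Rightarrow> ('m \<Rightarrow> nat ^ 'd) \<Rightarrow> real \<Rightarrow> real ^ 'm \<Rightarrow> real ^ 'n"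
  where "dual_density v dv w \<alpha> lam y =
    (\<chi> l. exp (- 1 - (lam + (transpose (weighted_moment_matrix v dv w \<alpha>) *v y) $ l)
                       * (1 / (dv $ l * w $ l))))"

definition dual_objective ::
    "('n \<Rightarrow> real ^ 'd) \<Rightarrow> real ^ 'n \<Rightarrow> real ^ 'n \<Rightarrow> ('m \<Rightarrow> nat ^ 'd) \<Rightarrow> real \<Rightarrow> real ^ 'm \<Rightarrow> real ^ 'm \<Rightarrow> real"
  where "dual_objective v dv w \<alpha> lam m y =
    y \<bullet> m + (\<Sum>l\<in>UNIV. dv $ l * dual_density v dv w \<alpha> lam y $ l)"

definition dual_solution ::
    "('n \<Rightarrow> real ^ 'd) \<Rightarrow> real ^ 'n \<Rightarrow> real ^ 'n \<Rightarrow> ('m \<Rightarrow> nat ^ 'd) \<Rightarrow> real \<Rightarrow> real ^ 'm \<Rightarrow> real ^ 'm"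
  where "dual_solution v dv w \<alpha> lam m = arg_min (dual_objective v dv w \<alpha> lam m) (\<lambda>_. True)"

definition next_moments ::
    "('n \<Rightarrow> real ^ 'd) \<Rightarrow> real ^ 'n \<Rightarrow> real ^ 'n \<Rightarrow> ('m \<Rightarrow> nat ^ 'd) \<Rightarrow> ('k \<Rightarrow> nat ^ 'd) \<Rightarrow> real
      \<Rightarrow> real ^ 'm \<Rightarrow> real ^ 'k"
  where "next_moments v dv w \<alpha> \<gamma> lam m =
    moment_matrix v dv \<gamma> *v reconstruction v dv w \<alpha> lam m"

text \<open>\<open>gram_matrix v dv f \<gamma> \<alpha>\<close> is the sum over \<open>l\<close> of \<open>dv $ l * f $ l\<close> times the outer product
  of \<open>monom_vec \<gamma> (v l)\<close> (rows) and \<open>monom_vec \<alpha> (v l)\<close> (columns). With \<open>f\<close> the reconstruction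
  at \<open>m\<close>, the case \<open>\<gamma> = \<alpha>\<close> gives \<open>H\<close> and the general case gives \<open>B\<close>.\<close>

definition gram_matrix ::
    "('n \<Rightarrow> real ^ 'd) \<Rightarrow> real ^ 'n \<Rightarrow> real ^ 'n \<Rightarrow> ('k \<Rightarrow> nat ^ 'd) \<Rightarrow> ('m \<Rightarrow> nat ^ 'd) \<Rightarrow> real ^ 'm ^ 'k"
  where "gram_matrix v dv f \<gamma> \<alpha> =
    (\<chi> i j. \<Sum>l\<in>UNIV. dv $ l * f $ l * monom_vec \<gamma> (v l) $ i * monom_vec \<alpha> (v l) $ j)"

definition H_matrix ::
    "('n \<Rightarrow> real ^ 'd) \<Rightarrow> real ^ 'n \<Rightarrow> real ^ 'n \<Rightarrow> ('m \<Rightarrow> nat ^ 'd) \<Rightarrow> real \<Rightarrow> real ^ 'm \<Rightarrow> real ^ 'm ^ 'm"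
  where "H_matrix v dv w \<alpha> lam m = gram_matrix v dv (reconstruction v dv w \<alpha> lam m) \<alpha> \<alpha>"

definition B_matrix ::
    "('n \<Rightarrow> real ^ 'd) \<Rightarrow> real ^ 'n \<Rightarrow> real ^ 'n \<Rightarrow> ('m \<Rightarrow> nat ^ 'd) \<Rightarrow> ('k \<Rightarrow> nat ^ 'd) \<Rightarrow> real
      \<Rightarrow> real ^ 'm \<Rightarrow> real ^ 'm ^ 'k"
  where "B_matrix v dv w \<alpha> \<gamma> lam m = gram_matrix v dv (reconstruction v dv w \<alpha> lam m) \<gamma> \<alpha>"

end

(* A moment vector m is matched by the exponential density with parameter y exactly when y is the
   minimiser of the dual potential; such a y exists because the potential is coercive for realizable
   m. Hence y* is the inverse of the map F sending y to its moments, and the tangent inequality for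
   t ln t identifies the primal minimiser with the density at y*.

   Analyticity of the inverse is obtained without complex analysis: absolutely summable power series
   form a Banach algebra on which exp is defined, so the equation F(y + u) = F(y) + r s
   can be solved for u inside that algebra by the contraction principle. Evaluation at a point s of
   the unit cube is a continuous algebra homomorphism and turns the solution into a power series
   expansion of y*. *)

theory Submission
  imports Defs
begin

section \<open>The Banach algebra of summable families\<close>

text \<open>The variable is rescaled so that everything lives on the fixed cube
  \<open>\<bar>s $ i\<bar> \<le> 1\<close>: there all monomials are bounded by 1, evaluation has
  norm at most 1 on summable families, and the factor r alone carries the radius of convergence.
  Coordinate functions have norm 1, so the datum \<open>r *\<^sub>R s\<close> is small enough for
  the contraction only once r is small. The fixed point yields just some preimage of F(y) + r s.
  That this preimage is the minimiser follows from a global fact: a parameter with moments m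
  strictly minimises the potential of m, so the arg min is a left inverse of F. The same local
  solvability shows that the realizable vectors form an open set. The reconstruction and the higher
  moments are both sums of \<open>d l * density y l\<close> times vectors q l, so a single
  analyticity lemma with q free serves both.\<close>

typedef 'a l1 = "{f :: 'a \<Rightarrow> real. f summable_on UNIV}"
  morphisms l1_coeff Abs_l1
  by (rule exI[of _ "\<lambda>_. 0"]) simp

setup_lifting type_definition_l1

lemma l1_coeff_summable: "l1_coeff a summable_on UNIV"
  using l1_coeff by auto

text \<open>For real families unconditional summability is absolute; hence the type is the usual l1
  space although its definition mentions no absolute values.\<close>

lemma l1_coeff_abs_summable: "(\<lambda>x. \<bar>l1_coeff a x\<bar>) summable_on UNIV"
  using l1_coeff_summable[of a] summable_on_iff_abs_summable_on_real[of "l1_coeff a" UNIV] by simp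

lemma l1_eqI: "(\<And>x. l1_coeff a x = l1_coeff b x) \<Longrightarrow> a = b"
  by (simp add: l1_coeff_inject[symmetric] fun_eq_iff)

instantiation l1 :: (type) real_vector
begin

lift_definition zero_l1 :: "'a l1" is "\<lambda>_. 0" by simp
lift_definition plus_l1 :: "'a l1 \<Rightarrow> 'a l1 \<Rightarrow> 'a l1" is "\<lambda>f g x. f x + g x"
  by (rule summable_on_add)
lift_definition uminus_l1 :: "'a l1 \<Rightarrow> 'a l1" is "\<lambda>f x. - f x"
  by (simp add: summable_on_uminus)
lift_definition minus_l1 :: "'a l1 \<Rightarrow> 'a l1 \<Rightarrow> 'a l1" is "\<lambda>f g x. f x - g x"
  by (auto simp: diff_conv_add_uminus simp del: add_uminus_conv_diff intro!: summable_on_add summable_on_uminus[THEN iffD2])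
lift_definition scaleR_l1 :: "real \<Rightarrow> 'a l1 \<Rightarrow> 'a l1" is "\<lambda>c f x. c * f x"
  by (rule summable_on_cmult_right)

instance
  by standard (transfer; simp add: algebra_simps fun_eq_iff)+

end

instantiation l1 :: (type) real_normed_vector
begin

definition norm_l1 :: "'a l1 \<Rightarrow> real" where "norm_l1 a = (\<Sum>\<^sub>\<infinity>x. \<bar>l1_coeff a x\<bar>)"
definition sgn_l1 :: "'a l1 \<Rightarrow> 'a l1" where "sgn_l1 a = a /\<^sub>R norm a"
definition dist_l1 :: "'a l1 \<Rightarrow> 'a l1 \<Rightarrow> real" where "dist_l1 a b = norm (a - b)"
definition uniformity_l1 :: "('a l1 \<times> 'a l1) filter"
  where "uniformity_l1 = (INF e\<in>{0<..}. principal {(a, b). dist a b < e})"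
definition open_l1 :: "'a l1 set \<Rightarrow> bool"
  where "open_l1 S = (\<forall>a\<in>S. \<forall>\<^sub>F (a', b) in uniformity. a' = a \<longrightarrow> b \<in> S)"

instance
proof
  fix a b :: "'a l1" and r :: real
  have nonneg: "norm a \<ge> 0" by (simp add: norm_l1_def infsum_nonneg)
  have sa: "(\<lambda>x. \<bar>l1_coeff c x\<bar>) summable_on UNIV" for c :: "'a l1" by (rule l1_coeff_abs_summable)
  show "norm a = 0 \<longleftrightarrow> a = 0"
  proof
    assume "norm a = 0"
    then have "\<bar>l1_coeff a x\<bar> = 0" for x
      using nonneg_infsum_le_0D[of "\<lambda>x. \<bar>l1_coeff a x\<bar>" UNIV x] sa[of a]
      by (simp add: norm_l1_def)
    then show "a = 0" by (intro l1_eqI) (simp add: zero_l1.rep_eq)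
  qed (simp add: norm_l1_def zero_l1.rep_eq)
  have "norm (a + b) \<le> (\<Sum>\<^sub>\<infinity>x. \<bar>l1_coeff a x\<bar> + \<bar>l1_coeff b x\<bar>)"
    unfolding norm_l1_def
    by (intro infsum_mono summable_on_add sa) (simp add: plus_l1.rep_eq)
  then show "norm (a + b) \<le> norm a + norm b"
    by (simp add: norm_l1_def infsum_add sa)
  show "norm (r *\<^sub>R a) = \<bar>r\<bar> * norm a"
    by (simp add: norm_l1_def scaleR_l1.rep_eq abs_mult infsum_cmult_right')
qed (rule sgn_l1_def dist_l1_def uniformity_l1_def open_l1_def)+

end

lemma abs_l1_coeff_le_norm: "\<bar>l1_coeff a x\<bar> \<le> norm a"
proof -
  have "(\<Sum>y\<in>{x}. \<bar>l1_coeff a y\<bar>) \<le> norm a"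
    unfolding norm_l1_def by (rule finite_sum_le_infsum) (auto intro: l1_coeff_abs_summable)
  then show ?thesis by simp
qed

lemma bounded_linear_l1_coeff: "bounded_linear (\<lambda>a. l1_coeff a x)"
  by (rule bounded_linear_intro[where K = 1])
    (simp_all add: plus_l1.rep_eq scaleR_l1.rep_eq abs_l1_coeff_le_norm)

instance l1 :: (type) banach
proof
  fix X :: "nat \<Rightarrow> 'a l1"
  assume X: "Cauchy X"
  have "Cauchy (\<lambda>n. l1_coeff (X n) x)" for x
    by (rule bounded_linear.Cauchy[OF bounded_linear_l1_coeff X])
  then have "\<forall>x. \<exists>L. (\<lambda>n. l1_coeff (X n) x) \<longlonglongrightarrow> L"
    using convergentD[OF real_Cauchy_convergent] by blast
  then obtain f where "\<forall>x. (\<lambda>n. l1_coeff (X n) x) \<longlonglongrightarrow> f x"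
    by (rule choice[THEN exE])
  then have f: "(\<lambda>n. l1_coeff (X n) x) \<longlonglongrightarrow> f x" for x by (rule spec)
  \<comment> \<open>Over a fixed finite set the Cauchy estimate passes to the pointwise limit. The
    bound does not depend on the set, so it controls the full norm of the difference as well as its
    summability.\<close>
  have tail: "\<exists>N. \<forall>n\<ge>N. \<forall>F. finite F \<longrightarrow> (\<Sum>x\<in>F. \<bar>l1_coeff (X n) x - f x\<bar>) \<le> e" if "e > 0" for e
  proof -
    obtain N where N: "\<And>m n. m \<ge> N \<Longrightarrow> n \<ge> N \<Longrightarrow> norm (X m - X n) < e"
      using CauchyD[OF X \<open>e > 0\<close>] by blast
    have "(\<Sum>x\<in>F. \<bar>l1_coeff (X n) x - f x\<bar>) \<le> e" if "n \<ge> N" "finite F" for n F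
    proof (rule tendsto_upperbound)
      show "(\<lambda>m. \<Sum>x\<in>F. \<bar>l1_coeff (X n) x - l1_coeff (X m) x\<bar>)
          \<longlonglongrightarrow> (\<Sum>x\<in>F. \<bar>l1_coeff (X n) x - f x\<bar>)"
        by (intro tendsto_sum tendsto_rabs tendsto_diff tendsto_const f)
      have "(\<Sum>x\<in>F. \<bar>l1_coeff (X n) x - l1_coeff (X m) x\<bar>) \<le> e" if "m \<ge> N" for m
      proof -
        have "(\<Sum>x\<in>F. \<bar>l1_coeff (X n - X m) x\<bar>) \<le> norm (X n - X m)"
          unfolding norm_l1_def using \<open>finite F\<close>
          by (intro finite_sum_le_infsum l1_coeff_abs_summable) auto
        then show ?thesis using N[OF \<open>n \<ge> N\<close> that] by (simp add: minus_l1.rep_eq)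
      qed
      then show "\<forall>\<^sub>F m in sequentially. (\<Sum>x\<in>F. \<bar>l1_coeff (X n) x - l1_coeff (X m) x\<bar>) \<le> e"
        by (auto simp: eventually_sequentially)
    qed simp
    then show ?thesis by blast
  qed
  have abs_summable: "(\<lambda>x. \<bar>g x\<bar>) summable_on UNIV"
    if "\<And>F. finite F \<Longrightarrow> (\<Sum>x\<in>F. \<bar>g x\<bar>) \<le> e" for g :: "'a \<Rightarrow> real" and e
    using that by (intro nonneg_bdd_above_summable_on bdd_aboveI2[where M = e]) simp_all
  obtain N where "\<forall>F. finite F \<longrightarrow> (\<Sum>x\<in>F. \<bar>l1_coeff (X N) x - f x\<bar>) \<le> 1"
    using tail[OF zero_less_one] by blast
  then have "(\<lambda>x. \<bar>l1_coeff (X N) x - f x\<bar>) summable_on UNIV"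
    by (intro abs_summable[where e = 1]) simp
  then have "(\<lambda>x. l1_coeff (X N) x - f x) summable_on UNIV"
    unfolding summable_on_iff_abs_summable_on_real[of "\<lambda>x. l1_coeff (X N) x - f x"] by simp
  from summable_on_add[OF l1_coeff_summable[of "X N"] summable_on_uminus[THEN iffD2, OF this]]
  have "f summable_on UNIV" by simp
  then have [simp]: "l1_coeff (Abs_l1 f) = f" by (simp add: Abs_l1_inverse)
  have "\<exists>N. \<forall>n\<ge>N. norm (X n - Abs_l1 f) < e" if "e > 0" for e
  proof -
    obtain N where N: "\<forall>n\<ge>N. \<forall>F. finite F \<longrightarrow> (\<Sum>x\<in>F. \<bar>l1_coeff (X n) x - f x\<bar>) \<le> e / 2"
      using tail[OF half_gt_zero[OF \<open>e > 0\<close>]] by blast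
    have "norm (X n - Abs_l1 f) \<le> e / 2" if "n \<ge> N" for n
      unfolding norm_l1_def
      by (rule infsum_le_finite_sums[OF l1_coeff_abs_summable])
        (use N that in \<open>simp add: minus_l1.rep_eq\<close>)
    then have "norm (X n - Abs_l1 f) < e" if "n \<ge> N" for n
      using that \<open>e > 0\<close> by (rule_tac le_less_trans[of _ "e / 2"]) simp_all
    then show ?thesis by blast
  qed
  then have "X \<longlonglongrightarrow> Abs_l1 f" by (auto simp: LIMSEQ_iff)
  then show "convergent X" by (rule convergentI)
qed

section \<open>Unit vectors and extension by linearity\<close>

lift_definition l1_delta :: "'a \<Rightarrow> 'a l1" is "\<lambda>x y. if y = x then 1 else 0"
  by (rule finite_nonzero_values_imp_summable_on) (auto intro: finite_subset[of _ "{_}"])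

lemma norm_l1_delta [simp]: "norm (l1_delta x) = 1"
proof -
  have "norm (l1_delta x) = (\<Sum>\<^sub>\<infinity>y\<in>{x}. \<bar>l1_coeff (l1_delta x) y\<bar>)"
    unfolding norm_l1_def by (rule infsum_cong_neutral) (auto simp: l1_delta.rep_eq)
  then show ?thesis by (simp add: l1_delta.rep_eq)
qed

text \<open>The universal property of \<open>l1\<close>: a bounded family \<open>\<phi>\<close> extends uniquely to a
  bounded linear map. Multiplication and evaluation of power series are both instances.\<close>

definition l1_lift :: "('a \<Rightarrow> 'b::banach) \<Rightarrow> 'a l1 \<Rightarrow> 'b"
  where "l1_lift \<phi> a = (\<Sum>\<^sub>\<infinity>x. l1_coeff a x *\<^sub>R \<phi> x)"

lemma l1_lift_abs_summable:
  assumes "\<And>x. norm (\<phi> x) \<le> C"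
  shows "(\<lambda>x. norm (l1_coeff a x *\<^sub>R \<phi> x)) summable_on UNIV"
proof (rule summable_on_comparison_test[where f = "\<lambda>x. \<bar>l1_coeff a x\<bar> * C"])
  show "(\<lambda>x. \<bar>l1_coeff a x\<bar> * C) summable_on UNIV"
    by (rule summable_on_cmult_left[OF l1_coeff_abs_summable])
qed (use assms in \<open>auto intro: mult_left_mono\<close>)

lemma l1_lift_has_sum:
  assumes "\<And>x. norm (\<phi> x) \<le> C"
  shows "((\<lambda>x. l1_coeff a x *\<^sub>R \<phi> x) has_sum l1_lift \<phi> a) UNIV"
  unfolding l1_lift_def
  by (rule has_sum_infsum, rule abs_summable_summable, rule l1_lift_abs_summable, rule assms)

lemma norm_l1_lift_le:
  assumes "\<And>x. norm (\<phi> x) \<le> C"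
  shows "norm (l1_lift \<phi> a) \<le> norm a * C"
proof -
  have "norm (l1_lift \<phi> a) \<le> (\<Sum>\<^sub>\<infinity>x. norm (l1_coeff a x *\<^sub>R \<phi> x))"
    unfolding l1_lift_def by (rule norm_infsum_bound, rule l1_lift_abs_summable, rule assms)
  also have "\<dots> \<le> (\<Sum>\<^sub>\<infinity>x. \<bar>l1_coeff a x\<bar> * C)"
  proof (rule infsum_mono)
    show "(\<lambda>x. norm (l1_coeff a x *\<^sub>R \<phi> x)) summable_on UNIV"
      by (rule l1_lift_abs_summable, rule assms)
    show "(\<lambda>x. \<bar>l1_coeff a x\<bar> * C) summable_on UNIV"
      by (rule summable_on_cmult_left[OF l1_coeff_abs_summable])
  qed (use assms in \<open>auto intro: mult_left_mono\<close>)
  finally show ?thesis by (simp add: norm_l1_def infsum_cmult_left')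
qed

lemma bounded_linear_l1_lift:
  assumes "\<And>x. norm (\<phi> x) \<le> C"
  shows "bounded_linear (l1_lift \<phi>)"
proof (rule bounded_linear_intro[OF _ _ norm_l1_lift_le])
  fix a b :: "'a l1" and r :: real
  have s: "((\<lambda>x. l1_coeff a x *\<^sub>R \<phi> x) has_sum l1_lift \<phi> a) UNIV" for a
    by (rule l1_lift_has_sum, rule assms)
  show "l1_lift \<phi> (a + b) = l1_lift \<phi> a + l1_lift \<phi> b"
    using has_sum_add[OF s[of a] s[of b]] s[of "a + b"]
    by (auto simp: plus_l1.rep_eq scaleR_left_distrib intro: has_sum_unique)
  show "l1_lift \<phi> (r *\<^sub>R a) = r *\<^sub>R l1_lift \<phi> a"
    using has_sum_bounded_linear[OF bounded_linear_scaleR_right[of r] s[of a]] s[of "r *\<^sub>R a"]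
    by (auto simp: scaleR_l1.rep_eq intro: has_sum_unique)
qed (rule assms)

lemma l1_lift_delta [simp]: "l1_lift \<phi> (l1_delta x) = \<phi> x"
proof -
  have "l1_lift \<phi> (l1_delta x) = (\<Sum>\<^sub>\<infinity>y\<in>{x}. l1_coeff (l1_delta x) y *\<^sub>R \<phi> y)"
    unfolding l1_lift_def by (rule infsum_cong_neutral) (auto simp: l1_delta.rep_eq)
  then show ?thesis by (simp add: l1_delta.rep_eq)
qed

lemma l1_lift_l1_delta [simp]: "l1_lift l1_delta a = a"
proof (rule l1_eqI)
  fix x
  have "((\<lambda>y. l1_coeff (l1_coeff a y *\<^sub>R l1_delta y) x) has_sum l1_coeff (l1_lift l1_delta a) x) UNIV"
    by (rule has_sum_bounded_linear[OF bounded_linear_l1_coeff l1_lift_has_sum[where C = 1]]) simp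
  moreover have "((\<lambda>y. l1_coeff (l1_coeff a y *\<^sub>R l1_delta y) x) has_sum l1_coeff a x) UNIV"
    by (rule has_sum_finite_neutralI[of "{x}"]) (auto simp: scaleR_l1.rep_eq l1_delta.rep_eq)
  ultimately show "l1_coeff (l1_lift l1_delta a) x = l1_coeff a x"
    by (rule has_sum_unique)
qed

text \<open>Each element is the norm-convergent sum of multiples of unit vectors, so bounded linear
  maps are determined by their values there. This replaces rearrangements of double series in all
  algebra identities below.\<close>

lemma l1_linear_ext:
  assumes f: "bounded_linear f" and g: "bounded_linear g"
    and eq: "\<And>x. f (l1_delta x) = g (l1_delta x)"
  shows "f a = g a"
proof -
  have "((\<lambda>x. l1_coeff a x *\<^sub>R l1_delta x) has_sum a) UNIV"
    using l1_lift_has_sum[of l1_delta 1 a] by simp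
  from has_sum_bounded_linear[OF f this] has_sum_bounded_linear[OF g this]
  show ?thesis
    by (auto simp: linear_cmul[OF bounded_linear.linear[OF f]]
        linear_cmul[OF bounded_linear.linear[OF g]] eq intro: has_sum_unique)
qed

section \<open>Convolution algebra over a monoid and its characters\<close>

instantiation l1 :: (monoid_add) real_normed_algebra_1
begin

definition one_l1 :: "'a l1" where "one_l1 = l1_delta 0"
text \<open>Convolution, written as the bilinear extension of the monoid operation on unit vectors:
  the inner lift translates \<open>b\<close> by \<open>x\<close>, the outer one superposes the
  translates. For exponents in \<open>nat ^ 'm\<close> it is the Cauchy product.\<close>

definition times_l1 :: "'a l1 \<Rightarrow> 'a l1 \<Rightarrow> 'a l1"
  where "times_l1 a b = l1_lift (\<lambda>x. l1_lift (\<lambda>y. l1_delta (x + y)) b) a"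

instance
proof
  fix a b c :: "'a l1" and r :: real
  have shift: "norm (l1_lift (\<lambda>y. l1_delta (x + y)) b) \<le> norm b" for x :: 'a and b
    using norm_l1_lift_le[of "\<lambda>y. l1_delta (x + y)" 1 b] by simp
  have shift_lin: "bounded_linear (l1_lift (\<lambda>y. l1_delta (x + y)))" for x :: 'a
    by (rule bounded_linear_l1_lift[where C = 1]) simp
  have left: "bounded_linear (\<lambda>a. a * b)" for b :: "'a l1"
    unfolding times_l1_def by (rule bounded_linear_l1_lift, rule shift)
  show norm_mult: "norm (a * b) \<le> norm a * norm b" for a b :: "'a l1"
    unfolding times_l1_def by (rule norm_l1_lift_le, rule shift)
  have s: "((\<lambda>x. l1_coeff a x *\<^sub>R l1_lift (\<lambda>y. l1_delta (x + y)) b) has_sum (a * b)) UNIV"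
    for a b :: "'a l1"
    unfolding times_l1_def by (rule l1_lift_has_sum, rule shift)
  \<comment> \<open>In the right factor the product is not a lift of a fixed family, because the
    family itself depends on \<open>b\<close>; linearity is therefore checked term by term in the
    expansion of \<open>a\<close>.\<close>
  have right: "bounded_linear (\<lambda>b. a * b)" for a :: "'a l1"
  proof (rule bounded_linear_intro[where K = "norm a"])
    fix b c :: "'a l1" and r :: real
    show "a * (b + c) = a * b + a * c"
      using has_sum_add[OF s[of a b] s[of a c]] s[of a "b + c"]
      by (auto simp: linear_add[OF bounded_linear.linear[OF shift_lin]] scaleR_right_distrib
          intro: has_sum_unique)
    show "a * (r *\<^sub>R b) = r *\<^sub>R (a * b)"
      using has_sum_bounded_linear[OF bounded_linear_scaleR_right[of r] s[of a b]] s[of a "r *\<^sub>R b"]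
      by (auto simp: linear_cmul[OF bounded_linear.linear[OF shift_lin]] mult.commute
          intro: has_sum_unique)
    show "norm (a * b) \<le> norm b * norm a" using norm_mult[of a b] by (simp add: mult.commute)
  qed
  have delta_mult: "l1_delta x * l1_delta y = l1_delta (x + y)" for x y :: 'a
    by (simp add: times_l1_def)
  note lin = left right bounded_linear_compose[OF left left] bounded_linear_compose[OF left right]
    bounded_linear_compose[OF right left] bounded_linear_compose[OF right right] bounded_linear_ident
  show "(a + b) * c = a * c + b * c" by (rule linear_add[OF bounded_linear.linear[OF left]])
  show "a * (b + c) = a * b + a * c" by (rule linear_add[OF bounded_linear.linear[OF right]])
  show "r *\<^sub>R a * b = r *\<^sub>R (a * b)" by (rule linear_cmul[OF bounded_linear.linear[OF left]])
  show "a * r *\<^sub>R b = r *\<^sub>R (a * b)" by (rule linear_cmul[OF bounded_linear.linear[OF right]])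
  \<comment> \<open>The three factors are replaced by unit vectors one at a time, which leaves
    associativity of the monoid.\<close>
  show "a * b * c = a * (b * c)"
  proof (rule l1_linear_ext[where a = a and f = "\<lambda>a. a * b * c" and g = "\<lambda>a. a * (b * c)"])
    fix x
    show "l1_delta x * b * c = l1_delta x * (b * c)"
    proof (rule l1_linear_ext[where a = b and f = "\<lambda>b. l1_delta x * b * c"
          and g = "\<lambda>b. l1_delta x * (b * c)"])
      fix y
      show "l1_delta x * l1_delta y * c = l1_delta x * (l1_delta y * c)"
        by (rule l1_linear_ext[where a = c and f = "\<lambda>c. l1_delta x * l1_delta y * c"
              and g = "\<lambda>c. l1_delta x * (l1_delta y * c)"], (rule lin)+)
          (simp add: delta_mult add.assoc)
    qed (rule lin)+
  qed (rule lin)+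
  show "1 * a = a"
    by (rule l1_linear_ext[where a = a and f = "\<lambda>a. 1 * a" and g = "\<lambda>a. a"], (rule lin)+)
      (simp add: one_l1_def delta_mult)
  show "a * 1 = a"
    by (rule l1_linear_ext[where a = a and f = "\<lambda>a. a * 1" and g = "\<lambda>a. a"], (rule lin)+)
      (simp add: one_l1_def delta_mult)
  show norm_one: "norm (1 :: 'a l1) = 1" by (simp add: one_l1_def)
  show "(0 :: 'a l1) \<noteq> 1"
  proof
    assume eq: "(0 :: 'a l1) = 1"
    show False using norm_one unfolding eq[symmetric] by simp
  qed
qed

end

lemma l1_delta_mult: "l1_delta x * l1_delta y = l1_delta (x + y)"
  by (simp add: times_l1_def)

text \<open>A bounded character of the monoid extends to a multiplicative functional: both sides are
  bounded linear in each factor and agree on unit vectors.\<close>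

lemma l1_lift_mult:
  fixes \<phi> :: "'a::monoid_add \<Rightarrow> real"
  assumes bound: "\<And>x. \<bar>\<phi> x\<bar> \<le> 1" and add: "\<And>x y. \<phi> (x + y) = \<phi> x * \<phi> y"
  shows "l1_lift \<phi> (a * b) = l1_lift \<phi> a * l1_lift \<phi> b"
proof -
  have lin: "bounded_linear (l1_lift \<phi>)"
    by (rule bounded_linear_l1_lift[where C = 1]) (use bound in simp)
  have right: "bounded_linear (\<lambda>b. l1_lift \<phi> (c * b))" for c
    using bounded_linear_compose[OF lin bounded_linear_mult_right] .
  have left: "bounded_linear (\<lambda>a. l1_lift \<phi> (a * b))"
    using bounded_linear_compose[OF lin bounded_linear_mult_left] .
  have "l1_lift \<phi> (l1_delta x * b) = \<phi> x * l1_lift \<phi> b" for x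
    by (rule l1_linear_ext[where a = b and f = "\<lambda>b. l1_lift \<phi> (l1_delta x * b)"
          and g = "\<lambda>b. \<phi> x * l1_lift \<phi> b"])
      (simp_all add: right l1_delta_mult add bounded_linear_compose[OF bounded_linear_mult_right lin])
  then show ?thesis
    by (intro l1_linear_ext[where a = a and f = "\<lambda>a. l1_lift \<phi> (a * b)"
          and g = "\<lambda>a. l1_lift \<phi> a * l1_lift \<phi> b"])
      (simp_all add: left bounded_linear_compose[OF bounded_linear_mult_left lin])
qed

text \<open>A continuous unital homomorphism may be applied term by term to the exponential
  series.\<close>

lemma l1_lift_exp:
  fixes \<phi> :: "'a::monoid_add \<Rightarrow> real"
  assumes bound: "\<And>x. \<bar>\<phi> x\<bar> \<le> 1" and add: "\<And>x y. \<phi> (x + y) = \<phi> x * \<phi> y" and zero: "\<phi> 0 = 1"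
  shows "l1_lift \<phi> (exp a) = exp (l1_lift \<phi> a)"
proof -
  have lin: "bounded_linear (l1_lift \<phi>)"
    by (rule bounded_linear_l1_lift[where C = 1]) (use bound in simp)
  have power: "l1_lift \<phi> (a ^ n) = l1_lift \<phi> a ^ n" for n
    by (induction n) (simp_all add: one_l1_def zero l1_lift_mult[of \<phi>] bound add)
  have "(\<lambda>n. l1_lift \<phi> (a ^ n /\<^sub>R fact n)) sums l1_lift \<phi> (exp a)"
    by (rule bounded_linear.sums[OF lin exp_converges])
  moreover have "(\<lambda>n. l1_lift \<phi> (a ^ n /\<^sub>R fact n)) sums exp (l1_lift \<phi> a)"
    using exp_converges[of "l1_lift \<phi> a"]
    by (simp add: linear_cmul[OF bounded_linear.linear[OF lin]] power)
  ultimately show ?thesis by (rule sums_unique2)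
qed

section \<open>Contractions from functions flat at zero\<close>

text \<open>Strict differentiability at 0 with derivative 0: the Lipschitz constant on small balls
  about 0 tends to 0. Comparing two arbitrary nearby points, not just \<open>x\<close> with 0, is
  what makes such a map a contraction.\<close>

definition strictly_flat_at_zero :: "('a::real_normed_vector \<Rightarrow> 'b::real_normed_vector) \<Rightarrow> bool"
  where "strictly_flat_at_zero f \<longleftrightarrow> f 0 = 0 \<and>
    (\<forall>\<epsilon>>0. \<exists>\<rho>>0. \<forall>x y. norm x \<le> \<rho> \<longrightarrow> norm y \<le> \<rho> \<longrightarrow> norm (f x - f y) \<le> \<epsilon> * norm (x - y))"

lemma strictly_flat_at_zero_bounded_linear:
  assumes f: "strictly_flat_at_zero f" and T: "bounded_linear T" and D: "bounded_linear D"
  shows "strictly_flat_at_zero (\<lambda>x. D (f (T x)))"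
  unfolding strictly_flat_at_zero_def
proof (intro conjI allI impI)
  interpret T: bounded_linear T by fact
  interpret D: bounded_linear D by fact
  show "D (f (T 0)) = 0" using f by (simp add: strictly_flat_at_zero_def T.zero D.zero)
  fix \<epsilon> :: real assume "\<epsilon> > 0"
  obtain A where A: "A > 0" "\<And>x. norm (T x) \<le> norm x * A" using T.pos_bounded by blast
  obtain B where B: "B > 0" "\<And>x. norm (D x) \<le> norm x * B" using D.pos_bounded by blast
  from A(1) B(1) \<open>\<epsilon> > 0\<close> have "\<epsilon> / (A * B) > 0" by simp
  then obtain \<rho> where \<rho>: "\<rho> > 0"
    "\<And>x y. norm x \<le> \<rho> \<Longrightarrow> norm y \<le> \<rho> \<Longrightarrow> norm (f x - f y) \<le> \<epsilon> / (A * B) * norm (x - y)"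
    using f unfolding strictly_flat_at_zero_def by blast
  have "norm (D (f (T x)) - D (f (T y))) \<le> \<epsilon> * norm (x - y)"
    if "norm x \<le> \<rho> / A" "norm y \<le> \<rho> / A" for x y
  proof -
    have small: "norm (T z) \<le> \<rho>" if "norm z \<le> \<rho> / A" for z
      using A(2)[of z] that A(1) by (simp add: field_simps)
    have "norm (D (f (T x)) - D (f (T y))) \<le> norm (f (T x) - f (T y)) * B"
      using B(2)[of "f (T x) - f (T y)"] by (simp add: D.diff)
    also have "\<dots> \<le> \<epsilon> / (A * B) * norm (T x - T y) * B"
      using \<rho>(2)[OF small[OF that(1)] small[OF that(2)]] B(1) by (intro mult_right_mono) simp_all
    also have "\<dots> \<le> \<epsilon> / (A * B) * (norm (x - y) * A) * B"
      using A B \<open>\<epsilon> > 0\<close> by (intro mult_right_mono mult_left_mono) (simp_all flip: T.diff)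
    also have "\<dots> = \<epsilon> * norm (x - y)" using A B by (simp add: field_simps)
    finally show ?thesis .
  qed
  moreover have "\<rho> / A > 0" using \<rho>(1) A(1) by simp
  ultimately show "\<exists>\<rho>>0. \<forall>x y. norm x \<le> \<rho> \<longrightarrow> norm y \<le> \<rho> \<longrightarrow>
      norm (D (f (T x)) - D (f (T y))) \<le> \<epsilon> * norm (x - y)"
    by blast
qed

lemma strictly_flat_at_zero_add:
  assumes f: "strictly_flat_at_zero f" and g: "strictly_flat_at_zero g"
  shows "strictly_flat_at_zero (\<lambda>x. f x + g x)"
  unfolding strictly_flat_at_zero_def
proof (intro conjI allI impI)
  show "f 0 + g 0 = 0" using f g by (simp add: strictly_flat_at_zero_def)
  fix \<epsilon> :: real assume "\<epsilon> > 0"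
  then have half: "\<epsilon> / 2 > 0" by simp
  obtain \<rho> where \<rho>: "\<rho> > 0"
    "\<And>x y. norm x \<le> \<rho> \<Longrightarrow> norm y \<le> \<rho> \<Longrightarrow> norm (f x - f y) \<le> \<epsilon> / 2 * norm (x - y)"
    using f half unfolding strictly_flat_at_zero_def by blast
  obtain \<sigma> where \<sigma>: "\<sigma> > 0"
    "\<And>x y. norm x \<le> \<sigma> \<Longrightarrow> norm y \<le> \<sigma> \<Longrightarrow> norm (g x - g y) \<le> \<epsilon> / 2 * norm (x - y)"
    using g half unfolding strictly_flat_at_zero_def by blast
  have "norm (f x + g x - (f y + g y)) \<le> \<epsilon> * norm (x - y)"
    if "norm x \<le> min \<rho> \<sigma>" "norm y \<le> min \<rho> \<sigma>" for x y
    using norm_diff_triangle_ineq[of "f x" "g x" "f y" "g y"] \<rho>(2)[of x y] \<sigma>(2)[of x y] that by simp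
  moreover have "min \<rho> \<sigma> > 0" using \<rho>(1) \<sigma>(1) by simp
  ultimately show "\<exists>\<rho>>0. \<forall>x y. norm x \<le> \<rho> \<longrightarrow> norm y \<le> \<rho> \<longrightarrow>
      norm (f x + g x - (f y + g y)) \<le> \<epsilon> * norm (x - y)"
    by blast
qed

lemma strictly_flat_at_zero_sum:
  assumes "\<And>i. i \<in> I \<Longrightarrow> strictly_flat_at_zero (f i)"
  shows "strictly_flat_at_zero (\<lambda>x. \<Sum>i\<in>I. f i x)"
  using assms
proof (induction I rule: infinite_finite_induct)
  case (insert i I)
  then show ?case by (simp add: strictly_flat_at_zero_add)
qed (auto simp: strictly_flat_at_zero_def intro: exI[of _ "1::real"])

text \<open>Telescoping with the factors kept in order, so that no commutativity enters. Exponents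
  are shifted by one to keep \<open>\<rho> ^ n\<close> free of a truncated subtraction.\<close>

lemma norm_power_diff_le:
  fixes a b :: "'a::real_normed_algebra_1"
  assumes "norm a \<le> \<rho>" "norm b \<le> \<rho>"
  shows "norm (a ^ Suc n - b ^ Suc n) \<le> of_nat (Suc n) * \<rho> ^ n * norm (a - b)"
proof (induction n)
  case (Suc n)
  have "\<rho> \<ge> 0" using assms(1) norm_ge_zero[of a] by linarith
  have "norm (a ^ Suc (Suc n) - b ^ Suc (Suc n)) =
      norm (a * (a ^ Suc n - b ^ Suc n) + (a - b) * b ^ Suc n)"
    by (simp add: algebra_simps)
  also have "\<dots> \<le> norm (a * (a ^ Suc n - b ^ Suc n)) + norm ((a - b) * b ^ Suc n)"
    by (rule norm_triangle_ineq)
  also have "\<dots> \<le> norm a * norm (a ^ Suc n - b ^ Suc n) + norm (a - b) * norm (b ^ Suc n)"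
    by (intro add_mono norm_mult_ineq)
  also have "\<dots> \<le> \<rho> * (of_nat (Suc n) * \<rho> ^ n * norm (a - b)) + norm (a - b) * \<rho> ^ Suc n"
    using assms \<open>\<rho> \<ge> 0\<close> Suc.IH
    by (intro add_mono mult_mono order_trans[OF norm_power_ineq] power_mono) simp_all
  also have "\<dots> = of_nat (Suc (Suc n)) * \<rho> ^ Suc n * norm (a - b)"
    by (simp add: algebra_simps)
  finally show ?case .
qed simp

text \<open>The series of \<open>exp a - 1 - a\<close> starts in degree 2, so every difference of
  terms retains a factor \<open>\<rho>\<close> besides \<open>norm (a - b)\<close>.\<close>

lemma strictly_flat_at_zero_exp:
  "strictly_flat_at_zero (\<lambda>a :: 'a::{real_normed_algebra_1,banach}. exp a - 1 - a)"
  unfolding strictly_flat_at_zero_def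
proof (intro conjI allI impI)
  fix \<epsilon> :: real assume "\<epsilon> > 0"
  \<comment> \<open>With \<open>\<rho> \<le> 1\<close> the powers \<open>\<rho> ^ Suc n\<close> are
    at most \<open>\<rho>\<close>; the majorant \<open>\<rho> * norm (a - b) / fact n\<close> then
    sums to \<open>\<rho> * exp 1 * norm (a - b)\<close>, hence the quotient by
    \<open>exp 1\<close>.\<close>
  define \<rho> where "\<rho> = min 1 (\<epsilon> / exp 1)"
  have \<rho>: "0 < \<rho>" "\<rho> \<le> 1" "\<rho> * exp 1 \<le> \<epsilon>"
    using \<open>\<epsilon> > 0\<close> by (auto simp: \<rho>_def min_def field_simps)
  have tail: "(\<lambda>n. a ^ (n + 2) /\<^sub>R fact (n + 2)) sums (exp a - 1 - a)" for a :: 'a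
    using sums_split_initial_segment[OF exp_converges[of a], of 2]
    by (simp add: numeral_2_eq_2 algebra_simps)
  have "norm ((exp a - 1 - a) - (exp b - 1 - b)) \<le> \<epsilon> * norm (a - b)"
    if a: "norm a \<le> \<rho>" and b: "norm b \<le> \<rho>" for a b :: 'a
  proof -
    define t where "t n = a ^ (n + 2) /\<^sub>R fact (n + 2) - b ^ (n + 2) /\<^sub>R fact (n + 2)" for n
    define g where "g n = \<rho> * norm (a - b) * (1 ^ n /\<^sub>R fact n)" for n
    have t: "t sums ((exp a - 1 - a) - (exp b - 1 - b))"
      unfolding t_def by (intro sums_diff tail)
    have g: "g sums (\<rho> * norm (a - b) * exp 1)"
      unfolding g_def by (intro sums_mult exp_converges)
    have le: "norm (t n) \<le> g n" for n
    proof -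
      have "norm (t n) = norm (a ^ Suc (Suc n) - b ^ Suc (Suc n)) / fact (n + 2)"
        by (simp add: t_def flip: scaleR_diff_right) (simp add: divide_inverse mult.commute)
      also have "\<dots> \<le> (of_nat (Suc (Suc n)) * \<rho> ^ Suc n * norm (a - b)) / fact (n + 2)"
        by (intro divide_right_mono norm_power_diff_le a b) simp
      also have "\<dots> = \<rho> ^ Suc n * norm (a - b) / fact (Suc n)"
        unfolding add_2_eq_Suc' fact_Suc[of "Suc n"] by (simp del: fact_Suc of_nat_Suc)
      also have "\<dots> \<le> \<rho> * norm (a - b) / fact n"
        using \<rho> by (intro frac_le mult_right_mono fact_mono)
          (auto simp: power_le_one mult_left_le)
      also have "\<dots> = g n" by (simp add: g_def divide_inverse)
      finally show ?thesis .
    qed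
    have "norm ((exp a - 1 - a) - (exp b - 1 - b)) \<le> \<rho> * norm (a - b) * exp 1"
      using norm_suminf_le[OF le sums_summable[OF g]] sums_unique[OF t] sums_unique[OF g] by simp
    also have "\<dots> = (\<rho> * exp 1) * norm (a - b)" by simp
    also have "\<dots> \<le> \<epsilon> * norm (a - b)" by (intro mult_right_mono \<rho>(3)) simp
    finally show ?thesis .
  qed
  with \<rho>(1) show "\<exists>\<rho>>0. \<forall>a b :: 'a. norm a \<le> \<rho> \<longrightarrow> norm b \<le> \<rho> \<longrightarrow>
      norm ((exp a - 1 - a) - (exp b - 1 - b)) \<le> \<epsilon> * norm (a - b)"
    by blast
qed simp

lemma strictly_flat_at_zero_fixpoint:
  fixes N :: "'a::banach \<Rightarrow> 'a"
  assumes N: "strictly_flat_at_zero N"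
  shows "\<exists>r>0. \<exists>u. u = r *\<^sub>R b + N u"
proof -
  obtain \<rho> where \<rho>: "\<rho> > 0"
    and lip: "\<And>x y. norm x \<le> \<rho> \<Longrightarrow> norm y \<le> \<rho> \<Longrightarrow> norm (N x - N y) \<le> 1 / 2 * norm (x - y)"
    using N half_gt_zero[OF zero_less_one] unfolding strictly_flat_at_zero_def by blast
  \<comment> \<open>Half the radius is reserved for \<open>r *\<^sub>R b\<close>; the other half
    bounds \<open>N u\<close>, since \<open>N\<close> has Lipschitz constant 1/2 and vanishes at 0.
    Adding 1 keeps the denominator positive when \<open>b\<close> is 0.\<close>
  define r where "r = \<rho> / (2 * (norm b + 1))"
  have pos: "norm b + 1 > 0" using norm_ge_zero[of b] by linarith
  then have "r > 0" using \<rho> by (simp add: r_def)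
  have "r * norm b \<le> r * (norm b + 1)" using \<open>r > 0\<close> by simp
  also have "\<dots> = \<rho> / 2" using pos by (simp add: r_def field_simps)
  finally have rb: "norm (r *\<^sub>R b) \<le> \<rho> / 2" using \<open>r > 0\<close> by simp
  have "\<exists>!u\<in>cball 0 \<rho>. r *\<^sub>R b + N u = u"
  proof (rule Banach_fix[where c = "1 / 2"])
    have "norm (r *\<^sub>R b + N u) \<le> \<rho>" if "norm u \<le> \<rho>" for u
      using norm_triangle_ineq[of "r *\<^sub>R b" "N u"] rb lip[of u 0] that N \<rho>
      by (simp add: strictly_flat_at_zero_def)
    then show "(\<lambda>u. r *\<^sub>R b + N u) ` cball 0 \<rho> \<subseteq> cball 0 \<rho>" by auto
    show "complete (cball (0::'a) \<rho>)" by (simp add: complete_eq_closed)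
  qed (use \<rho> lip in \<open>auto simp: dist_norm\<close>)
  then obtain u where "u = r *\<^sub>R b + N u" by metis
  with \<open>r > 0\<close> show ?thesis by blast
qed

section \<open>Evaluation of power series\<close>

lemma monom_eval_0 [simp]: "monom_eval 0 s = 1"
  by (simp add: monom_eval_def)

lemma monom_eval_add: "monom_eval (\<beta> + \<gamma>) s = monom_eval \<beta> s * monom_eval \<gamma> s"
  by (simp add: monom_eval_def power_add prod.distrib)

lemma monom_eval_axis: "monom_eval (axis k 1) s = s $ k"
proof -
  have "monom_eval (axis k 1) s = (\<Prod>i\<in>UNIV. if i = k then s $ i else 1)"
    unfolding monom_eval_def by (rule prod.cong) (auto simp: axis_def)
  then show ?thesis by simp
qed

lemma monom_eval_scaleR: "monom_eval \<beta> (r *\<^sub>R s) = r ^ (\<Sum>i\<in>UNIV. \<beta> $ i) * monom_eval \<beta> s"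
  by (simp add: monom_eval_def power_mult_distrib prod.distrib power_sum)

lemma abs_monom_eval_le_1: "(\<And>i. \<bar>s $ i\<bar> \<le> 1) \<Longrightarrow> \<bar>monom_eval \<beta> s\<bar> \<le> 1"
  unfolding monom_eval_def abs_prod by (rule prod_le_1) (simp add: power_abs power_le_one)

text \<open>Some coordinate occurs with positive exponent and contributes at most its absolute
  value; all remaining factors are at most 1.\<close>

lemma abs_monom_eval_le_norm:
  assumes s: "\<And>i. \<bar>s $ i\<bar> \<le> 1" and "\<beta> \<noteq> 0"
  shows "\<bar>monom_eval \<beta> s\<bar> \<le> norm s"
proof -
  obtain k where "\<beta> $ k \<noteq> 0" using \<open>\<beta> \<noteq> 0\<close> by (auto simp: vec_eq_iff)
  then have "\<bar>s $ k\<bar> ^ (\<beta> $ k) \<le> \<bar>s $ k\<bar>" using power_decreasing[of 1 "\<beta> $ k" "\<bar>s $ k\<bar>"] s by simp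
  have "\<bar>monom_eval \<beta> s\<bar> = \<bar>s $ k\<bar> ^ (\<beta> $ k) * (\<Prod>i\<in>UNIV - {k}. \<bar>s $ i\<bar> ^ (\<beta> $ i))"
    unfolding monom_eval_def abs_prod by (subst prod.remove[of UNIV k]) (simp_all add: power_abs)
  also have "\<dots> \<le> \<bar>s $ k\<bar> * 1"
    using s by (intro mult_mono \<open>\<bar>s $ k\<bar> ^ (\<beta> $ k) \<le> \<bar>s $ k\<bar>\<close> prod_le_1) (auto simp: power_le_one intro!: prod_nonneg)
  also have "\<dots> \<le> norm s" using component_le_norm_cart[of s k] by simp
  finally show ?thesis .
qed

definition l1_eval :: "real ^ 'm::finite \<Rightarrow> (nat ^ 'm) l1 \<Rightarrow> real"
  where "l1_eval s = l1_lift (\<lambda>\<beta>. monom_eval \<beta> s)"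

context
  fixes s :: "real ^ 'm::finite"
  assumes s: "\<And>i. \<bar>s $ i\<bar> \<le> 1"
begin

lemma bounded_linear_l1_eval: "bounded_linear (l1_eval s)"
  unfolding l1_eval_def
  by (rule bounded_linear_l1_lift[where C = 1]) (use abs_monom_eval_le_1[OF s] in simp)

lemma l1_eval_add: "l1_eval s (a + b) = l1_eval s a + l1_eval s b"
  by (rule linear_add[OF bounded_linear.linear[OF bounded_linear_l1_eval]])

lemma l1_eval_diff: "l1_eval s (a - b) = l1_eval s a - l1_eval s b"
  by (rule linear_diff[OF bounded_linear.linear[OF bounded_linear_l1_eval]])

lemma l1_eval_minus: "l1_eval s (- a) = - l1_eval s a"
  by (rule linear_neg[OF bounded_linear.linear[OF bounded_linear_l1_eval]])

lemma l1_eval_scaleR: "l1_eval s (c *\<^sub>R a) = c * l1_eval s a"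
  using linear_cmul[OF bounded_linear.linear[OF bounded_linear_l1_eval]] by simp

lemma l1_eval_sum: "l1_eval s (\<Sum>i\<in>I. f i) = (\<Sum>i\<in>I. l1_eval s (f i))"
  by (rule linear_sum[OF bounded_linear.linear[OF bounded_linear_l1_eval]])

lemma l1_eval_one: "l1_eval s 1 = 1"
  by (simp add: l1_eval_def one_l1_def)

lemma l1_eval_axis: "l1_eval s (l1_delta (axis k 1)) = s $ k"
  by (simp add: l1_eval_def monom_eval_axis del: One_nat_def)

lemma l1_eval_exp: "l1_eval s (exp a) = exp (l1_eval s a)"
  unfolding l1_eval_def
  by (rule l1_lift_exp) (use abs_monom_eval_le_1[OF s] in \<open>simp_all add: monom_eval_add\<close>)

lemma l1_eval_has_sum: "((\<lambda>\<beta>. monom_eval \<beta> s * l1_coeff a \<beta>) has_sum l1_eval s a) UNIV"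
  using l1_lift_has_sum[of "\<lambda>\<beta>. monom_eval \<beta> s" 1 a] abs_monom_eval_le_1[OF s]
  by (simp add: l1_eval_def mult.commute)

text \<open>The constant monomial cancels in the difference, and every other monomial is at most
  \<open>norm s\<close>. This estimate is the source of continuity for represented
  functions.\<close>

lemma l1_eval_diff_l1_eval_0: "\<bar>l1_eval s a - l1_eval 0 a\<bar> \<le> norm a * norm s"
proof -
  have monom_0: "monom_eval \<beta> (0 :: real ^ 'm) = (if \<beta> = 0 then 1 else 0)" for \<beta>
    by (auto simp: monom_eval_def vec_eq_iff intro!: prod_zero)
  have bound: "\<bar>monom_eval \<beta> s - monom_eval \<beta> 0\<bar> \<le> norm s" for \<beta>
    using abs_monom_eval_le_norm[OF s, of \<beta>] by (simp add: monom_0)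
  have "((\<lambda>\<beta>. l1_coeff a \<beta> * (monom_eval \<beta> s - monom_eval \<beta> 0)) has_sum
      l1_lift (\<lambda>\<beta>. monom_eval \<beta> s - monom_eval \<beta> 0) a) UNIV"
    using l1_lift_has_sum[of "\<lambda>\<beta>. monom_eval \<beta> s - monom_eval \<beta> 0" "norm s" a] bound by simp
  moreover have "((\<lambda>\<beta>. l1_coeff a \<beta> * monom_eval \<beta> s + - (l1_coeff a \<beta> * monom_eval \<beta> 0)) has_sum
      (l1_eval s a + - l1_eval 0 a)) UNIV"
    unfolding l1_eval_def
    using l1_lift_has_sum[of "\<lambda>\<beta>. monom_eval \<beta> s" 1 a] l1_lift_has_sum[of "\<lambda>\<beta>. monom_eval \<beta> (0::real^'m)" 1 a]
      abs_monom_eval_le_1[OF s]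
    by (intro has_sum_add has_sum_uminusI) (simp_all add: monom_0)
  ultimately have "l1_eval s a - l1_eval 0 a = l1_lift (\<lambda>\<beta>. monom_eval \<beta> s - monom_eval \<beta> 0) a"
    by (simp add: right_diff_distrib has_sum_unique)
  then show ?thesis
    using norm_l1_lift_le[of "\<lambda>\<beta>. monom_eval \<beta> s - monom_eval \<beta> 0" "norm s" a] bound by simp
qed

end

lemma has_sum_vec:
  fixes f :: "'a \<Rightarrow> real ^ 'b::finite"
  assumes "\<And>i. ((\<lambda>x. f x $ i) has_sum S $ i) A"
  shows "(f has_sum S) A"
  unfolding has_sum_def
  by (rule vec_tendstoI) (use assms in \<open>simp add: has_sum_def sum_component\<close>)

text \<open>Absolutely convergent expansion on a closed cube of half-side \<open>r\<close> about
  \<open>a\<close>, in the rescaled variable. Stated through algebra elements, it can be fed with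
  fixed points and exponentials directly.\<close>

definition l1_representable_at :: "(real ^ 'm::finite \<Rightarrow> real ^ 'b::finite) \<Rightarrow> real ^ 'm \<Rightarrow> bool"
  where "l1_representable_at f a \<longleftrightarrow> (\<exists>r>0. \<exists>U :: (nat ^ 'm) l1 ^ 'b.
    \<forall>s. (\<forall>i. \<bar>s $ i\<bar> \<le> 1) \<longrightarrow> f (a + r *\<^sub>R s) = (\<chi> i. l1_eval s (U $ i)))"

lemma ball_in_cube:
  fixes a :: "real ^ 'm::finite"
  assumes "r > 0" "x \<in> ball a r"
  shows "\<bar>((x - a) /\<^sub>R r) $ i\<bar> \<le> 1"
proof -
  have "\<bar>(x - a) $ i\<bar> \<le> r"
    using component_le_norm_cart[of "x - a" i] assms by (simp add: dist_norm norm_minus_commute)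
  then show ?thesis using \<open>r > 0\<close> by (simp add: abs_mult field_simps)
qed

lemma real_analytic_onI:
  assumes "\<And>a. a \<in> S \<Longrightarrow> l1_representable_at f a"
  shows "f real_analytic_on S"
  unfolding real_analytic_on_def
proof
  fix a assume "a \<in> S"
  then obtain r U where "r > 0" and U: "\<And>s. (\<forall>i. \<bar>s $ i\<bar> \<le> 1) \<Longrightarrow> f (a + r *\<^sub>R s) = (\<chi> i. l1_eval s (U $ i))"
    using assms unfolding l1_representable_at_def by meson
  \<comment> \<open>Undoes the rescaling \<open>x - a = r *\<^sub>R s\<close>, under which a
    monomial gains the factor r to the power of its total degree.\<close>
  define c where "c \<beta> = (\<chi> i. l1_coeff (U $ i) \<beta> / r ^ (\<Sum>j\<in>UNIV. \<beta> $ j))" for \<beta>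
  have "((\<lambda>\<beta>. monom_eval \<beta> (x - a) *\<^sub>R c \<beta>) has_sum f x) UNIV" if x: "x \<in> ball a r" for x
  proof -
    define s where "s = (x - a) /\<^sub>R r"
    have s: "\<bar>s $ i\<bar> \<le> 1" for i
      unfolding s_def by (rule ball_in_cube[OF \<open>r > 0\<close> x])
    have x_eq: "x - a = r *\<^sub>R s" using \<open>r > 0\<close> by (simp add: s_def)
    have "monom_eval \<beta> (x - a) *\<^sub>R c \<beta> $ i = monom_eval \<beta> s * l1_coeff (U $ i) \<beta>" for \<beta> i
      using \<open>r > 0\<close> by (simp add: x_eq monom_eval_scaleR c_def)
    moreover have "f x $ i = l1_eval s (U $ i)" for i
      using U[of s] s by (simp flip: x_eq)
    ultimately show ?thesis
      by (intro has_sum_vec) (simp add: l1_eval_has_sum[OF s])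
  qed
  with \<open>r > 0\<close> show "\<exists>r>0. \<exists>c. \<forall>x\<in>ball a r. ((\<lambda>\<beta>. monom_eval \<beta> (x - a) *\<^sub>R c \<beta>) has_sum f x) UNIV"
    by blast
qed

lemma l1_representable_at_imp_continuous:
  assumes "l1_representable_at f a"
  shows "continuous (at a) f"
proof -
  obtain r U where "r > 0" and U: "\<And>s. (\<forall>i. \<bar>s $ i\<bar> \<le> 1) \<Longrightarrow> f (a + r *\<^sub>R s) = (\<chi> i. l1_eval s (U $ i))"
    using assms unfolding l1_representable_at_def by meson
  have "((\<lambda>x. f x $ i) \<longlongrightarrow> f a $ i) (at a)" for i
  proof (rule Lim_transform_bound[THEN Lim_null[THEN iffD2]])
    show "\<forall>\<^sub>F x in at a. norm (f x $ i - f a $ i) \<le> norm (norm (U $ i) / r * norm (x - a))"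
      unfolding eventually_at
    proof (intro exI[of _ r] conjI ballI impI \<open>r > 0\<close>)
      fix x assume "x \<noteq> a \<and> dist x a < r"
      then have x: "x \<in> ball a r" by (simp add: dist_commute)
      define s where "s = (x - a) /\<^sub>R r"
      have s: "\<bar>s $ i\<bar> \<le> 1" for i
        unfolding s_def by (rule ball_in_cube[OF \<open>r > 0\<close> x])
      have x_eq: "x = a + r *\<^sub>R s" using \<open>r > 0\<close> by (simp add: s_def)
      have "\<bar>f x $ i - f a $ i\<bar> \<le> norm (U $ i) * norm s"
        using U[of s] U[of 0] s l1_eval_diff_l1_eval_0[OF s] by (simp add: x_eq)
      then show "norm (f x $ i - f a $ i) \<le> norm (norm (U $ i) / r * norm (x - a))"
        using \<open>r > 0\<close> by (simp add: s_def divide_inverse mult.assoc)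
    qed
    show "((\<lambda>x. norm (U $ i) / r * norm (x - a)) \<longlongrightarrow> 0) (at a)"
      by (intro tendsto_mult_right_zero tendsto_norm_zero LIM_zero tendsto_ident_at)
  qed
  then show ?thesis unfolding continuous_at by (rule vec_tendstoI)
qed

section \<open>Exponential families\<close>

text \<open>Equality would read \<open>ln (1 + x) = x\<close>, which forces \<open>x = 0\<close>.
  The strictness yields uniqueness of both the dual and the primal minimiser.\<close>

lemma add_one_less_exp: "x \<noteq> 0 \<Longrightarrow> 1 + x < exp (x::real)"
  using exp_ge_add_one_self[of x] ln_eq_minus_one[of "1 + x"] ln_unique[of x "1 + x"]
  by (metis add_cancel_left_right add_diff_cancel_left' exp_gt_zero order_le_less)

text \<open>\<open>arg_min\<close> is a choice among minimisers, so its value is known only when the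
  minimum is strict.\<close>

lemma arg_min_eqI:
  fixes f :: "'a \<Rightarrow> real"
  assumes "P x" "\<And>y. P y \<Longrightarrow> y \<noteq> x \<Longrightarrow> f x < f y"
  shows "arg_min f P = x"
proof (rule arg_minI[where P = P and x = x])
  show "P x" by fact
  show "\<not> f y < f x" if "P y" for y using assms(2)[of y] that by (cases "y = x") auto
  show "x' = x" if "P x'" "\<forall>y. P y \<longrightarrow> \<not> f y < f x'" for x'
    using assms that by blast
qed

text \<open>For \<open>f > 0\<close> the function \<open>t \<mapsto> f t + exp (c - t)\<close> grows at least like \<open>f \<bar>t\<bar>\<close> at both ends:
  for negative \<open>t\<close> compare \<open>exp\<close> with its tangent of slope \<open>2 f\<close>.\<close>

lemma linear_add_exp_ge:
  fixes f c t :: real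
  assumes "f > 0"
  shows "f * t + exp (c - t) \<ge> f * \<bar>t\<bar> - 2 * f * \<bar>1 + c - ln (2 * f)\<bar>"
proof (cases "t \<ge> 0")
  case True
  have "exp (c - t) \<ge> 0" "2 * f * \<bar>1 + c - ln (2 * f)\<bar> \<ge> 0" using assms by simp_all
  then show ?thesis unfolding abs_of_nonneg[OF True] by linarith
next
  case False
  have "exp (c - t) = 2 * f * exp (c - t - ln (2 * f))"
    using assms by (simp add: exp_diff)
  also have "\<dots> \<ge> 2 * f * (1 + (c - t - ln (2 * f)))"
    using assms by (intro mult_left_mono exp_ge_add_one_self) simp
  finally have "exp (c - t) \<ge> 2 * f * (1 + c - ln (2 * f)) - 2 * f * t" by (simp add: algebra_simps)
  moreover have "2 * f * (1 + c - ln (2 * f)) \<ge> - (2 * f * \<bar>1 + c - ln (2 * f)\<bar>)"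
    using assms mult_left_mono[of "- \<bar>1 + c - ln (2 * f)\<bar>" "1 + c - ln (2 * f)" "2 * f"] by simp
  ultimately show ?thesis using False by simp
qed

lemma matrix_inv_mult:
  fixes A :: "real ^ 'n::finite ^ 'n"
  assumes "invertible A"
  shows "A ** matrix_inv A = mat 1" "matrix_inv A ** A = mat 1"
  using assms someI_ex[of "\<lambda>B. A ** B = mat 1 \<and> B ** A = mat 1"]
  by (simp_all add: invertible_def matrix_inv_def)

lemma matrix_vector_mult_uminus: "(- A) *v x = - (A *v x)" for A :: "real ^ 'n::finite ^ 'm::finite"
  by (simp add: matrix_vector_mult_def vec_eq_iff sum_negf)

text \<open>\<open>separating\<close> says that the vectors \<open>p l\<close> span the space, the
  form in which full rank is used; the offset \<open>c\<close> absorbs the regularisation.\<close>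

locale exponential_family =
  fixes p :: "'n::finite \<Rightarrow> real ^ 'm::finite" and d c :: "'n \<Rightarrow> real"
  assumes d_pos: "d l > 0"
    and separating: "(\<And>l. p l \<bullet> y = 0) \<Longrightarrow> y = 0"
begin

definition density :: "real ^ 'm \<Rightarrow> 'n \<Rightarrow> real"
  where "density y l = exp (c l - p l \<bullet> y)"

definition moments :: "('n \<Rightarrow> real ^ 'k) \<Rightarrow> real ^ 'm \<Rightarrow> real ^ 'k"
  where "moments q y = (\<Sum>l\<in>UNIV. (d l * density y l) *\<^sub>R q l)"

definition gram :: "('n \<Rightarrow> real ^ 'k) \<Rightarrow> real ^ 'm \<Rightarrow> real ^ 'm ^ 'k"
  where "gram q y = (\<chi> i j. \<Sum>l\<in>UNIV. d l * density y l * q l $ i * p l $ j)"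

definition potential :: "real ^ 'm \<Rightarrow> real ^ 'm \<Rightarrow> real"
  where "potential m y = y \<bullet> m + (\<Sum>l\<in>UNIV. d l * density y l)"

definition dual_point :: "real ^ 'm \<Rightarrow> real ^ 'm"
  where "dual_point m = arg_min (potential m) (\<lambda>_. True)"

lemma density_pos: "density y l > 0"
  by (simp add: density_def)

lemma density_add: "density (y + u) l = density y l * exp (- (p l \<bullet> u))"
  by (simp add: density_def inner_add_right algebra_simps flip: exp_add)

lemma gram_mult_vec: "gram q y *v h = (\<Sum>l\<in>UNIV. (d l * density y l * (p l \<bullet> h)) *\<^sub>R q l)"
proof (rule vec_eq_iff[THEN iffD2, rule_format])
  fix i
  have "(gram q y *v h) $ i = (\<Sum>j\<in>UNIV. \<Sum>l\<in>UNIV. d l * density y l * q l $ i * p l $ j * h $ j)"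
    by (simp add: gram_def matrix_vector_mult_def sum_distrib_right)
  also have "\<dots> = (\<Sum>l\<in>UNIV. \<Sum>j\<in>UNIV. d l * density y l * q l $ i * p l $ j * h $ j)"
    by (rule sum.swap)
  also have "\<dots> = (\<Sum>l\<in>UNIV. d l * density y l * (p l \<bullet> h) * q l $ i)"
    by (rule sum.cong) (simp_all add: inner_vec_def sum_distrib_left sum_distrib_right algebra_simps)
  finally show "(gram q y *v h) $ i = (\<Sum>l\<in>UNIV. (d l * density y l * (p l \<bullet> h)) *\<^sub>R q l) $ i"
    by (simp add: sum_component)
qed

text \<open>The quadratic form is a sum of squares \<open>(p l \<bullet> h)\<^sup>2\<close> with
  positive weights, not all zero by \<open>separating\<close>.\<close>

lemma gram_pos_def:
  assumes "h \<noteq> 0"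
  shows "h \<bullet> (gram p y *v h) > 0"
proof -
  obtain k where k: "p k \<bullet> h \<noteq> 0" using separating[of h] \<open>h \<noteq> 0\<close> by blast
  have "h \<bullet> (gram p y *v h) = (\<Sum>l\<in>UNIV. d l * density y l * (p l \<bullet> h)\<^sup>2)"
    by (simp add: gram_mult_vec inner_sum_right inner_commute power2_eq_square mult.assoc)
  also have "\<dots> > 0"
    by (rule sum_pos2[where i = k])
      (use k in \<open>auto intro!: mult_pos_pos mult_nonneg_nonneg less_imp_le[OF d_pos]
        less_imp_le[OF density_pos] d_pos density_pos\<close>)
  finally show ?thesis .
qed

lemma invertible_gram: "invertible (gram p y)"
proof -
  have "inj ((*v) (gram p y))"
    using gram_pos_def[of _ y]
    by (intro linear_injective_0[THEN iffD2] matrix_vector_mul_linear allI impI)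
      (metis inner_zero_right less_irrefl)
  then show ?thesis
    by (simp add: invertible_left_inverse matrix_left_invertible_injective)
qed

lemma gram_inverse:
  "matrix_inv (gram p y) *v (gram p y *v h) = h" "gram p y *v (matrix_inv (gram p y) *v h) = h"
  using invertible_gram[of y] by (simp_all add: matrix_vector_mul_assoc matrix_inv_mult)

lemma has_derivative_moments: "(moments q has_derivative (\<lambda>h. - (gram q y *v h))) (at y)"
proof -
  have "((\<lambda>y. (d l * exp (c l - p l \<bullet> y)) *\<^sub>R q l) has_derivative
      (\<lambda>h. - ((d l * density y l * (p l \<bullet> h)) *\<^sub>R q l))) (at y)" for l
    by (auto intro!: derivative_eq_intros simp: density_def)
  then have "(moments q has_derivative
      (\<lambda>h. \<Sum>l\<in>UNIV. - ((d l * density y l * (p l \<bullet> h)) *\<^sub>R q l))) (at y)"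
    unfolding moments_def[abs_def] density_def[abs_def] by (rule has_derivative_sum)
  then show ?thesis by (simp add: gram_mult_vec sum_negf)
qed

lemma inner_moments: "h \<bullet> moments p y = (\<Sum>l\<in>UNIV. d l * density y l * (p l \<bullet> h))"
  by (simp add: moments_def inner_sum_right inner_commute)

text \<open>Writing m as the moments at \<open>y\<close> turns the linear part of the potential into
  a sum over nodes. The increment becomes a positively weighted sum of
  \<open>exp (- t) - (1 - t)\<close>, strictly positive at a node where \<open>t\<close> is
  nonzero.\<close>

lemma potential_less:
  assumes "moments p y = m" "y' \<noteq> y"
  shows "potential m y < potential m y'"
proof -
  define t where "t l = p l \<bullet> (y' - y)" for l
  obtain k where "t k \<noteq> 0" using separating[of "y' - y"] \<open>y' \<noteq> y\<close> unfolding t_def by auto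
  have y': "density y' l = density y l * exp (- t l)" for l
    using density_add[of y "y' - y" l] by (simp add: t_def)
  have "potential m y' - potential m y =
      (y' - y) \<bullet> m + (\<Sum>l\<in>UNIV. d l * density y' l - d l * density y l)"
    by (simp add: potential_def sum_subtractf inner_diff_left)
  also have "\<dots> = (\<Sum>l\<in>UNIV. d l * density y l * (exp (- t l) - (1 + - t l)))"
    unfolding assms(1)[symmetric] inner_moments sum.distrib[symmetric]
    by (rule sum.cong) (simp_all add: y' t_def algebra_simps)
  also have "\<dots> > 0"
    by (rule sum_pos2[where i = k])
      (use add_one_less_exp[of "- t k"] \<open>t k \<noteq> 0\<close> exp_ge_add_one_self[of "- t _"] in
        \<open>auto intro!: mult_pos_pos mult_nonneg_nonneg less_imp_le[OF d_pos]
        less_imp_le[OF density_pos] d_pos density_pos\<close>)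
  finally show ?thesis by simp
qed

lemma dual_point_moments: "dual_point (moments p y) = y"
  unfolding dual_point_def by (rule arg_min_eqI) (auto intro: potential_less)

text \<open>A positive representation of m splits the potential into functions of the single numbers
  \<open>p l \<bullet> y\<close>, each growing linearly in both directions. Positivity of
  \<open>f\<close> is exactly what controls the side on which the exponential decays.\<close>

lemma potential_coercive:
  assumes m: "m = (\<Sum>l\<in>UNIV. (d l * f l) *\<^sub>R p l)" and f: "\<And>l. f l > 0"
  obtains B C where "B > 0" "\<And>y. potential m y \<ge> B * norm y - C"
proof -
  \<comment> \<open>Collects the weighted numbers \<open>p l \<bullet> y\<close>; it is injective by
    \<open>separating\<close> and hence bounded below by a multiple of the norm.\<close>
  define L :: "real ^ 'm \<Rightarrow> real ^ 'n" where "L y = (\<chi> l. d l * f l * (p l \<bullet> y))" for y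
  have "linear L"
    by (rule linearI) (simp_all add: L_def vec_eq_iff inner_add_right algebra_simps)
  moreover have "y = 0" if "L y = 0" for y
    using that d_pos f by (intro separating) (simp add: L_def vec_eq_iff order_less_imp_not_eq2)
  ultimately obtain B where B: "B > 0" "\<And>y. B * norm y \<le> norm (L y)"
    using linear_inj_bounded_below_pos[of L] linear_injective_0[of L] by blast
  define C where "C = (\<Sum>l\<in>UNIV. d l * (2 * f l * \<bar>1 + c l - ln (2 * f l)\<bar>))"
  have "potential m y \<ge> B * norm y - C" for y
  proof -
    have "B * norm y \<le> (\<Sum>l\<in>UNIV. \<bar>L y $ l\<bar>)"
      using B(2)[of y] norm_le_l1_cart[of "L y"] by linarith
    also have "\<dots> = (\<Sum>l\<in>UNIV. d l * (f l * \<bar>p l \<bullet> y\<bar>))"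
      using d_pos f by (simp add: L_def abs_mult less_imp_le mult.assoc)
    finally have "B * norm y - C \<le>
        (\<Sum>l\<in>UNIV. d l * (f l * \<bar>p l \<bullet> y\<bar> - 2 * f l * \<bar>1 + c l - ln (2 * f l)\<bar>))"
      by (simp add: C_def right_diff_distrib sum_subtractf)
    also have "\<dots> \<le> (\<Sum>l\<in>UNIV. d l * (f l * (p l \<bullet> y) + exp (c l - p l \<bullet> y)))"
      by (intro sum_mono mult_left_mono linear_add_exp_ge f less_imp_le[OF d_pos])
    also have "\<dots> = potential m y"
      by (simp add: potential_def m density_def inner_sum_right inner_commute sum.distrib
          distrib_left mult.assoc)
    finally show ?thesis .
  qed
  with B(1) show ?thesis by (rule that)
qed

lemma has_derivative_potential:
  "(potential m has_derivative (\<lambda>h. h \<bullet> (m - moments p y))) (at y)"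
proof -
  have "((\<lambda>y. y \<bullet> m + (\<Sum>l\<in>UNIV. d l * exp (c l - p l \<bullet> y))) has_derivative
      (\<lambda>h. h \<bullet> m + (\<Sum>l\<in>UNIV. d l * (exp (c l - p l \<bullet> y) * (0 - p l \<bullet> h))))) (at y)"
    by (auto intro!: derivative_eq_intros simp: mult_ac)
  then show ?thesis
    by (simp add: potential_def[abs_def] density_def inner_diff_right inner_moments sum_negf mult.assoc)
qed

lemma moments_surj:
  assumes m: "m = (\<Sum>l\<in>UNIV. (d l * f l) *\<^sub>R p l)" and f: "\<And>l. f l > 0"
  obtains y where "moments p y = m"
proof -
  obtain B C where "B > 0" and BC: "\<And>y. potential m y \<ge> B * norm y - C"
    using potential_coercive[OF m f] by blast
  \<comment> \<open>Outside this ball the coercive bound already exceeds the value at 0, so a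
    minimum over the ball is global; \<open>max 0\<close> keeps 0 in the ball.\<close>
  define R where "R = max 0 ((potential m 0 + C) / B)"
  have "continuous_on (cball 0 R) (potential m)"
    by (intro continuous_at_imp_continuous_on ballI has_derivative_continuous[OF has_derivative_potential])
  then obtain y where y: "y \<in> cball 0 R" "\<And>x. x \<in> cball 0 R \<Longrightarrow> potential m y \<le> potential m x"
    using continuous_attains_inf[of "cball 0 R" "potential m"] by (auto simp: R_def)
  have "potential m y \<le> potential m x" for x
  proof (cases "x \<in> cball 0 R")
    case False
    then have "(potential m 0 + C) / B < norm x" by (simp add: R_def)
    then have "potential m 0 < B * norm x - C" using \<open>B > 0\<close> by (simp add: field_simps)
    moreover have "potential m y \<le> potential m 0" by (rule y(2)) (simp add: R_def)
    ultimately show ?thesis using BC[of x] by linarith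
  qed (rule y(2))
  then have "(\<lambda>h. h \<bullet> (m - moments p y)) = (\<lambda>h. 0)"
    by (intro differential_zero_maxmin[OF _ _ has_derivative_potential, of y UNIV]) auto
  \<comment> \<open>The vanishing derivative is taken in the direction of the residual
    itself.\<close>
  then have "(m - moments p y) \<bullet> (m - moments p y) = 0" by meson
  then show ?thesis by (intro that[of y]) simp
qed

text \<open>The equation \<open>moments p (y + u) = moments p y + r *\<^sub>R s\<close> is solved for \<open>u\<close> as an element of
  the Banach algebra of power series in \<open>s\<close>. In the form \<open>u = - r *\<^sub>R K s + K (N u)\<close> with
  \<open>K = matrix_inv (gram p y)\<close>, the remainder \<open>N\<close> only contains \<open>exp a - 1 - a\<close>, hence is a
  contraction near \<open>0\<close>.\<close>

lemma moments_local_inverse: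
  obtains r :: real and U :: "(nat ^ 'm) l1 ^ 'm" where "r > 0"
    "\<forall>s. (\<forall>i. \<bar>s $ i\<bar> \<le> 1) \<longrightarrow>
      moments p (y + (\<chi> i. l1_eval s (U $ i))) = moments p y + r *\<^sub>R s"
proof -
  define K where "K = matrix_inv (gram p y)"
  \<comment> \<open>\<open>T l\<close> lifts the exponent \<open>- (p l \<bullet> u)\<close> to the
    algebra and \<open>D l\<close> spreads a scalar along \<open>K *v p l\<close>; both are bounded
    linear, so flatness of the exponential remainder passes to \<open>N\<close>. The vector
    \<open>b\<close> evaluates to \<open>- (K *v s)\<close>.\<close>
  define T :: "'n \<Rightarrow> (nat ^ 'm) l1 ^ 'm \<Rightarrow> (nat ^ 'm) l1"
    where "T l u = - (\<Sum>k\<in>UNIV. p l $ k *\<^sub>R u $ k)" for l u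
  define D :: "'n \<Rightarrow> (nat ^ 'm) l1 \<Rightarrow> (nat ^ 'm) l1 ^ 'm"
    where "D l a = (\<chi> i. (d l * density y l * (K *v p l) $ i) *\<^sub>R a)" for l a
  define N where "N u = (\<Sum>l\<in>UNIV. D l (exp (T l u) - 1 - T l u))" for u
  define b :: "(nat ^ 'm) l1 ^ 'm"
    where "b = (\<chi> i. \<Sum>k\<in>UNIV. (- K $ i $ k) *\<^sub>R l1_delta (axis k 1))"
  have "bounded_linear (T l)" for l
    unfolding T_def
    by (intro bounded_linear_minus bounded_linear_sum bounded_linear_const_scaleR bounded_linear_vec_nth)
  moreover have "bounded_linear (D l)" for l
  proof (rule bounded_linear_intro)
    show "norm (D l a) \<le> norm a * (\<Sum>i\<in>UNIV. \<bar>d l * density y l * (K *v p l) $ i\<bar>)" for a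
      unfolding norm_vec_def
      by (rule order_trans[OF L2_set_le_sum]) (simp_all add: D_def sum_distrib_left mult.commute)
  qed (simp_all add: D_def vec_eq_iff scaleR_right_distrib)
  ultimately have "strictly_flat_at_zero N"
    unfolding N_def
    by (intro strictly_flat_at_zero_sum strictly_flat_at_zero_bounded_linear[OF strictly_flat_at_zero_exp])
  then obtain r u where "r > 0" and u: "u = r *\<^sub>R b + N u"
    using strictly_flat_at_zero_fixpoint by blast
  have "\<forall>s. (\<forall>i. \<bar>s $ i\<bar> \<le> 1) \<longrightarrow>
    moments p (y + (\<chi> i. l1_eval s (u $ i))) = moments p y + r *\<^sub>R s"
  proof (intro allI impI)
    fix s :: "real ^ 'm" assume "\<forall>i. \<bar>s $ i\<bar> \<le> 1"
    then have s: "\<bar>s $ i\<bar> \<le> 1" for i by blast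
    note eval = l1_eval_add[OF s] l1_eval_diff[OF s] l1_eval_minus[OF s] l1_eval_scaleR[OF s]
      l1_eval_sum[OF s] l1_eval_one[OF s] l1_eval_axis[OF s] l1_eval_exp[OF s]
    define v where "v = (\<chi> i. l1_eval s (u $ i))"
    define e where "e l = exp (- (p l \<bullet> v)) - 1 + p l \<bullet> v" for l
    have T: "l1_eval s (T l u) = - (p l \<bullet> v)" for l
      by (simp add: T_def eval v_def inner_vec_def)
    have b: "l1_eval s (b $ i) = - (K *v s) $ i" for i
      by (simp add: b_def eval matrix_vector_mult_def sum_negf del: One_nat_def)
    have N: "l1_eval s (N u $ i) = (K *v (\<Sum>l\<in>UNIV. (d l * density y l * e l) *\<^sub>R p l)) $ i" for i
      by (simp add: N_def D_def eval T e_def sum_component linear_sum[OF matrix_vector_mul_linear]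
          linear_cmul[OF matrix_vector_mul_linear] mult_ac)
    have "v $ i = l1_eval s ((r *\<^sub>R b + N u) $ i)" for i
      unfolding v_def by (subst u) simp
    then have "v = K *v (- (r *\<^sub>R s) + (\<Sum>l\<in>UNIV. (d l * density y l * e l) *\<^sub>R p l))"
      by (simp add: vec_eq_iff eval b N linear_diff[OF matrix_vector_mul_linear] linear_cmul[OF matrix_vector_mul_linear])
    then have "gram p y *v v = - (r *\<^sub>R s) + (\<Sum>l\<in>UNIV. (d l * density y l * e l) *\<^sub>R p l)"
      by (simp add: K_def gram_inverse)
    \<comment> \<open>Expanding \<open>e l\<close> gives the shifted moments, the old moments and
      the linear term; the last is the Gram matrix applied to \<open>v\<close> and cancels against
      the left-hand side.\<close>
    also have "(\<Sum>l\<in>UNIV. (d l * density y l * e l) *\<^sub>R p l) =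
        moments p (y + v) - moments p y + gram p y *v v"
      unfolding moments_def gram_mult_vec sum_subtractf[symmetric] sum.distrib[symmetric]
      by (rule sum.cong[OF refl], subst density_add) (simp add: e_def algebra_simps)
    finally show "moments p (y + (\<chi> i. l1_eval s (u $ i))) = moments p y + r *\<^sub>R s"
      by (simp add: v_def algebra_simps)
  qed
  with \<open>r > 0\<close> show ?thesis by (rule that)
qed

section \<open>Analyticity and derivatives at a realizable vector\<close>

context
  fixes m f
  assumes m: "m = (\<Sum>l\<in>UNIV. (d l * f l) *\<^sub>R p l)" and f: "\<And>l. f l > 0"
begin

lemma moments_dual_point: "moments p (dual_point m) = m"
  using moments_surj[OF m f] dual_point_moments by metis

lemma dual_point_local:
  obtains r :: real and U :: "(nat ^ 'm) l1 ^ 'm" where "r > 0"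
    "\<forall>s. (\<forall>i. \<bar>s $ i\<bar> \<le> 1) \<longrightarrow>
      dual_point (m + r *\<^sub>R s) = dual_point m + (\<chi> i. l1_eval s (U $ i))"
proof -
  obtain r U where "r > 0" and U: "\<forall>s. (\<forall>i. \<bar>s $ i\<bar> \<le> 1) \<longrightarrow>
      moments p (dual_point m + (\<chi> i. l1_eval s (U $ i))) = m + r *\<^sub>R s"
    using moments_local_inverse[of "dual_point m"] unfolding moments_dual_point by blast
  have "\<forall>s. (\<forall>i. \<bar>s $ i\<bar> \<le> 1) \<longrightarrow>
      dual_point (m + r *\<^sub>R s) = dual_point m + (\<chi> i. l1_eval s (U $ i))"
  proof (intro allI impI)
    fix s :: "real ^ 'm" assume "\<forall>i. \<bar>s $ i\<bar> \<le> 1"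
    with U have eq: "moments p (dual_point m + (\<chi> i. l1_eval s (U $ i))) = m + r *\<^sub>R s" by blast
    show "dual_point (m + r *\<^sub>R s) = dual_point m + (\<chi> i. l1_eval s (U $ i))"
      unfolding eq[symmetric] by (rule dual_point_moments)
  qed
  from that[OF \<open>r > 0\<close> this] show ?thesis .
qed

text \<open>Nearby vectors are moments of some parameter, which the left inverse recovers. This
  provides both the two-sided inverse for differentiation and the openness of the realizable
  set.\<close>

lemma moments_dual_point_near:
  obtains r where "r > 0" "\<forall>x\<in>ball m r. moments p (dual_point x) = x"
proof -
  obtain r U where "r > 0" and U: "\<forall>s. (\<forall>i. \<bar>s $ i\<bar> \<le> 1) \<longrightarrow>
      moments p (dual_point m + (\<chi> i. l1_eval s (U $ i))) = m + r *\<^sub>R s"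
    using moments_local_inverse[of "dual_point m"] unfolding moments_dual_point by blast
  have "\<forall>x\<in>ball m r. moments p (dual_point x) = x"
  proof
    fix x assume x: "x \<in> ball m r"
    define s where "s = (x - m) /\<^sub>R r"
    have "\<forall>i. \<bar>s $ i\<bar> \<le> 1" unfolding s_def using ball_in_cube[OF \<open>r > 0\<close> x] by blast
    moreover have "m + r *\<^sub>R s = x" using \<open>r > 0\<close> by (simp add: s_def)
    ultimately have "moments p (dual_point m + (\<chi> i. l1_eval s (U $ i))) = x" using U by metis
    then show "moments p (dual_point x) = x" using dual_point_moments by metis
  qed
  from that[OF \<open>r > 0\<close> this] show ?thesis .
qed

lemma dual_point_representable: "l1_representable_at dual_point m"
proof -
  obtain r U where "r > 0" and U: "\<forall>s. (\<forall>i. \<bar>s $ i\<bar> \<le> 1) \<longrightarrow>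
      dual_point (m + r *\<^sub>R s) = dual_point m + (\<chi> i. l1_eval s (U $ i))"
    using dual_point_local by blast
  have "dual_point (m + r *\<^sub>R s) = (\<chi> i. l1_eval s ((\<chi> i. dual_point m $ i *\<^sub>R 1 + U $ i) $ i))"
    if "\<forall>i. \<bar>s $ i\<bar> \<le> 1" for s
    using that spec[OF U, of s]
    by (simp add: vec_eq_iff l1_eval_add[of s] l1_eval_scaleR[of s] l1_eval_one[of s])
  with \<open>r > 0\<close> show ?thesis unfolding l1_representable_at_def by blast
qed

lemma moments_dual_point_representable: "l1_representable_at (\<lambda>x. moments q (dual_point x)) m"
proof -
  obtain r U where "r > 0" and U: "\<forall>s. (\<forall>i. \<bar>s $ i\<bar> \<le> 1) \<longrightarrow>
      dual_point (m + r *\<^sub>R s) = dual_point m + (\<chi> i. l1_eval s (U $ i))"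
    using dual_point_local by blast
  \<comment> \<open>Displacing the parameter multiplies each density by the exponential of a linear
    form in the displacement, and this exponential can be formed inside the algebra.\<close>
  define V where "V = (\<chi> j. \<Sum>l\<in>UNIV. (d l * density (dual_point m) l * q l $ j) *\<^sub>R
      exp (- (\<Sum>i\<in>UNIV. p l $ i *\<^sub>R U $ i)))"
  have "moments q (dual_point (m + r *\<^sub>R s)) = (\<chi> j. l1_eval s (V $ j))"
    if s: "\<forall>i. \<bar>s $ i\<bar> \<le> 1" for s
  proof -
    have "l1_eval s (V $ j) = moments q (dual_point (m + r *\<^sub>R s)) $ j" for j
      using s spec[OF U, of s]
      by (simp add: V_def moments_def density_add l1_eval_sum[of s] l1_eval_scaleR[of s]
          l1_eval_exp[of s] l1_eval_minus[of s] inner_vec_def sum_component mult_ac)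
    then show ?thesis by (simp add: vec_eq_iff)
  qed
  with \<open>r > 0\<close> show ?thesis unfolding l1_representable_at_def by blast
qed

text \<open>The derivative of \<open>moments p\<close> is minus the Gram matrix. Its inverse is the
  derivative of the dual point because the latter is continuous, by its power series, and a local
  right inverse.\<close>

lemma has_derivative_dual_point:
  "(dual_point has_derivative (\<lambda>h. - matrix_inv (gram p (dual_point m)) *v h)) (at m)"
proof -
  obtain r where "r > 0" and r: "\<forall>x\<in>ball m r. moments p (dual_point x) = x"
    using moments_dual_point_near by blast
  show ?thesis
  proof (rule has_derivative_inverse_basic[OF has_derivative_moments[of p]])
    show "bounded_linear ((*v) (- matrix_inv (gram p (dual_point m))))"
      by (rule matrix_vector_mul_bounded_linear)
    show "(*v) (- matrix_inv (gram p (dual_point m))) \<circ> (\<lambda>h. - (gram p (dual_point m) *v h)) = id"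
      by (simp add: fun_eq_iff gram_inverse matrix_vector_mult_uminus linear_neg[OF matrix_vector_mul_linear])
    show "continuous (at m) dual_point"
      by (rule l1_representable_at_imp_continuous[OF dual_point_representable])
    show "moments p (dual_point x) = x" if "x \<in> ball m r" for x
      using r that by blast
  qed (use \<open>r > 0\<close> in auto)
qed

lemma has_derivative_moments_dual_point:
  "((\<lambda>x. moments q (dual_point x)) has_derivative
    (\<lambda>h. (gram q (dual_point m) ** matrix_inv (gram p (dual_point m))) *v h)) (at m)"
proof -
  have "((\<lambda>x. moments q (dual_point x)) has_derivative
    (\<lambda>h. - (gram q (dual_point m) *v (- matrix_inv (gram p (dual_point m)) *v h)))) (at m)"
    by (rule has_derivative_compose[OF has_derivative_dual_point has_derivative_moments])
  then show ?thesis
    by (simp add: matrix_vector_mult_uminus linear_neg[OF matrix_vector_mul_linear] flip: matrix_vector_mul_assoc)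
qed

end

end

section \<open>The entropy closure\<close>

text \<open>For positive \<open>f\<close> this is \<open>1 + x < exp x\<close> at
  \<open>x = ln (z / f)\<close>, scaled by \<open>f\<close>; the boundary value \<open>f = 0\<close>
  reduces to \<open>z > 0\<close>.\<close>

lemma mult_ln_ge_tangent:
  fixes f z :: real
  assumes "f \<ge> 0" "z > 0" "f \<noteq> z"
  shows "f * ln z + f - z < f * ln f"
proof (cases "f = 0")
  case False
  with \<open>f \<ge> 0\<close> have "f > 0" by simp
  have "1 + ln (z / f) < exp (ln (z / f))"
    using \<open>f > 0\<close> assms by (intro add_one_less_exp) simp
  then have "f * (1 + ln (z / f)) < f * (z / f)"
    using \<open>f > 0\<close> assms by (intro mult_strict_left_mono) simp_all
  then show ?thesis using \<open>f > 0\<close> assms by (simp add: ln_div algebra_simps)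
qed (use assms in simp)

text \<open>Agreement is known only on \<open>S\<close>, so the ball of convergence is shrunk into
  \<open>S\<close> while the coefficients stay the same.\<close>

lemma real_analytic_on_cong:
  assumes "f real_analytic_on S" "open S" "\<And>x. x \<in> S \<Longrightarrow> f x = g x"
  shows "g real_analytic_on S"
  unfolding real_analytic_on_def
proof
  fix a assume "a \<in> S"
  then obtain r c where "r > 0" and c: "\<forall>x\<in>ball a r. ((\<lambda>\<beta>. monom_eval \<beta> (x - a) *\<^sub>R c \<beta>) has_sum f x) UNIV"
    using assms(1) unfolding real_analytic_on_def by blast
  obtain r' where "r' > 0" "ball a r' \<subseteq> S"
    using assms(2) \<open>a \<in> S\<close> by (auto simp: open_contains_ball)
  have "\<forall>x\<in>ball a (min r r'). ((\<lambda>\<beta>. monom_eval \<beta> (x - a) *\<^sub>R c \<beta>) has_sum g x) UNIV"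
  proof
    fix x assume "x \<in> ball a (min r r')"
    then have "x \<in> ball a r" "x \<in> S" using \<open>ball a r' \<subseteq> S\<close> by auto
    then show "((\<lambda>\<beta>. monom_eval \<beta> (x - a) *\<^sub>R c \<beta>) has_sum g x) UNIV"
      using bspec[OF c] assms(3)[of x] by metis
  qed
  with \<open>r > 0\<close> \<open>r' > 0\<close>
  show "\<exists>r>0. \<exists>c. \<forall>x\<in>ball a r. ((\<lambda>\<beta>. monom_eval \<beta> (x - a) *\<^sub>R c \<beta>) has_sum g x) UNIV"
    by (intro exI[of _ "min r r'"] exI[of _ c] conjI) simp_all
qed

section \<open>Primal and dual problems as an exponential family\<close>

locale entropy_closure =
  fixes v :: "'n::finite \<Rightarrow> real ^ 'd::finite" and dv w :: "real ^ 'n"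
    and \<alpha> :: "'m::finite \<Rightarrow> nat ^ 'd" and lam :: real
  assumes dv_pos: "dv $ l > 0"
    and w_pos: "w $ l > 0"
    and full_rank: "rank (moment_matrix v dv \<alpha>) = CARD('m)"

sublocale entropy_closure \<subseteq> exponential_family
  "\<lambda>l. monom_vec \<alpha> (v l)" "\<lambda>l. dv $ l" "\<lambda>l. - 1 - lam / (dv $ l * w $ l)"
proof
  show "dv $ l > 0" for l by (rule dv_pos)
  fix y :: "real ^ 'm"
  assume y: "\<And>l. monom_vec \<alpha> (v l) \<bullet> y = 0"
  have "(transpose (moment_matrix v dv \<alpha>) *v y) $ l = dv $ l * (monom_vec \<alpha> (v l) \<bullet> y)" for l
    by (simp add: matrix_vector_mult_def transpose_def moment_matrix_def inner_vec_def
        sum_distrib_left mult.assoc)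
  then have "transpose (moment_matrix v dv \<alpha>) *v y = transpose (moment_matrix v dv \<alpha>) *v 0"
    using y by (simp add: vec_eq_iff)
  moreover have "inj ((*v) (transpose (moment_matrix v dv \<alpha>)))"
    using full_rank full_rank_injective[of "transpose (moment_matrix v dv \<alpha>)"]
    by (simp add: rank_transpose)
  ultimately show "y = 0" by (rule injD[rotated])
qed

context entropy_closure
begin

abbreviation p :: "'n \<Rightarrow> real ^ 'm" where "p l \<equiv> monom_vec \<alpha> (v l)"

lemma moment_matrix_mult_vec: "moment_matrix v dv \<beta> *v f = (\<Sum>l\<in>UNIV. (dv $ l * f $ l) *\<^sub>R monom_vec \<beta> (v l))"
  by (simp add: matrix_vector_mult_def moment_matrix_def vec_eq_iff sum_component mult_ac)

lemma weighted_moment_matrix_mult_vec: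
  "weighted_moment_matrix v dv w \<alpha> *v g = (\<Sum>l\<in>UNIV. (dv $ l * (w $ l * g $ l)) *\<^sub>R p l)"
  by (simp add: matrix_vector_mult_def weighted_moment_matrix_def moment_matrix_def vec_eq_iff
      sum_component mult_ac)

text \<open>Any positive density can be exchanged for an exponential one with the same moments, by
  surjectivity of the moment map onto the cone.\<close>

lemma realizable_eq: "realizable v dv \<alpha> = range (moments p)"
proof (intro equalityI subsetI)
  fix m assume "m \<in> realizable v dv \<alpha>"
  then obtain f where f: "m = (\<Sum>l\<in>UNIV. (dv $ l * f $ l) *\<^sub>R p l)" "\<forall>l. f $ l > 0"
    unfolding realizable_def moment_matrix_mult_vec by blast
  show "m \<in> range (moments p)"
    by (rule moments_surj[OF f(1)]) (use f(2) in auto)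
next
  fix m assume "m \<in> range (moments p)"
  then obtain y where "m = moments p y" by blast
  then show "m \<in> realizable v dv \<alpha>"
    unfolding realizable_def moment_matrix_mult_vec
    by (intro CollectI exI[of _ "\<chi> l. density y l"]) (simp add: moments_def density_pos)
qed

lemma dual_density_eq: "dual_density v dv w \<alpha> lam y = (\<chi> l. density y l)"
proof -
  have "(transpose (weighted_moment_matrix v dv w \<alpha>) *v y) $ l = dv $ l * w $ l * (p l \<bullet> y)" for l
    by (simp add: matrix_vector_mult_def transpose_def weighted_moment_matrix_def moment_matrix_def
        inner_vec_def sum_distrib_left mult_ac)
  then show ?thesis
    using dv_pos w_pos
    by (simp add: dual_density_def density_def vec_eq_iff add_divide_distrib less_imp_neq[symmetric])
qed

text \<open>An identity of functions on the whole space, both sides minimising the same function;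
  the primal side is identified only on the cone.\<close>

lemma dual_solution_eq: "dual_solution v dv w \<alpha> lam = dual_point"
  by (simp add: dual_solution_def[abs_def] dual_point_def[abs_def] dual_objective_def[abs_def]
      potential_def[abs_def] dual_density_eq)

text \<open>Weak duality: an affine minorant of the objective is constant on the feasible set, and
  it touches the objective only at the claimed minimiser.\<close>

lemma primal_solution_eq:
  assumes y: "moments p y = m"
  shows "primal_solution v dv w \<alpha> lam m = (\<chi> l. density y l / w $ l)"
  unfolding primal_solution_def
proof (rule arg_min_eqI)
  define z where "z = (\<chi> l. density y l / w $ l)"
  have wz: "w $ l * z $ l = density y l" for l
    using w_pos[of l] by (simp add: z_def)
  have z_pos: "z $ l > 0" for l
    using w_pos[of l] density_pos[of y l] by (simp add: z_def)
  show feasible_z: "primal_feasible v dv w \<alpha> m (\<chi> l. density y l / w $ l)"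
    unfolding z_def[symmetric] primal_feasible_def weighted_moment_matrix_mult_vec wz
    using y z_pos by (simp add: moments_def less_imp_le)
  \<comment> \<open>\<open>e\<close> is the objective per node, with the absolute value dropped
    since feasible \<open>g\<close> are nonnegative. \<open>b\<close> is its tangent at
    \<open>z\<close>; the sum of the tangents depends on \<open>g\<close> only through the moment
    constraint and equals minus the potential.\<close>
  define e where "e g l = dv $ l * (w $ l * g $ l * ln (w $ l * g $ l)) + lam * g $ l" for g :: "real ^ 'n" and l
  define b where "b g l = - (dv $ l * (w $ l * g $ l) * (p l \<bullet> y)) - dv $ l * density y l" for g :: "real ^ 'n" and l
  have objective: "primal_objective dv w lam g = (\<Sum>l\<in>UNIV. e g l)"
    if "primal_feasible v dv w \<alpha> m g" for g
    using that by (simp add: primal_objective_def primal_feasible_def e_def sum.distrib sum_distrib_left mult.assoc)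
  have sum_b: "(\<Sum>l\<in>UNIV. b g l) = - potential m y" if "primal_feasible v dv w \<alpha> m g" for g
  proof -
    have "m \<bullet> y = (\<Sum>l\<in>UNIV. dv $ l * (w $ l * g $ l) * (p l \<bullet> y))"
      using that by (auto simp: primal_feasible_def weighted_moment_matrix_mult_vec inner_sum_left)
    then show ?thesis
      by (simp add: b_def potential_def sum_subtractf sum_negf inner_commute)
  qed
  have b_eq: "b g l = dv $ l * (w $ l * g $ l * ln (density y l) + w $ l * g $ l - density y l) + lam * g $ l" for g l
    using dv_pos[of l] w_pos[of l]
    by (simp add: b_def density_def algebra_simps)
  have b_less: "b g l < e g l" if "g $ l \<ge> 0" "g $ l \<noteq> z $ l" for g l
  proof -
    have "w $ l * g $ l \<noteq> density y l" using that(2) wz[of l] w_pos[of l] by (metis mult_cancel_left order_less_irrefl)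
    then show ?thesis
      unfolding b_eq e_def using w_pos[of l] that(1) dv_pos[of l] density_pos[of y l]
      by (intro add_strict_right_mono mult_strict_left_mono mult_ln_ge_tangent) simp_all
  qed
  have b_z: "b z l = e z l" for l
    unfolding b_eq e_def wz by simp
  fix g assume g: "primal_feasible v dv w \<alpha> m g" and "g \<noteq> (\<chi> l. density y l / w $ l)"
  then obtain k where k: "g $ k \<noteq> z $ k" by (auto simp: vec_eq_iff z_def)
  have g_nonneg: "g $ l \<ge> 0" for l using g by (simp add: primal_feasible_def)
  have "primal_objective dv w lam z = (\<Sum>l\<in>UNIV. b z l)"
    using objective[OF feasible_z] by (simp add: b_z flip: z_def)
  also have "\<dots> = (\<Sum>l\<in>UNIV. b g l)"
    using sum_b[OF feasible_z] sum_b[OF g] by (simp flip: z_def)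
  also have "\<dots> < (\<Sum>l\<in>UNIV. e g l)"
  proof (rule sum_strict_mono_ex1)
    show "\<forall>l\<in>UNIV. b g l \<le> e g l"
    proof
      fix l
      show "b g l \<le> e g l"
      proof (cases "g $ l = z $ l")
        case True
        then have "b g l = b z l" "e g l = e z l" by (simp_all add: b_def e_def)
        then show ?thesis by (simp add: b_z)
      qed (use b_less[OF g_nonneg] in \<open>simp add: less_imp_le\<close>)
    qed
    show "\<exists>l\<in>UNIV. b g l < e g l" using b_less[OF g_nonneg k] by blast
  qed simp
  also have "\<dots> = primal_objective dv w lam g" by (rule objective[OF g, symmetric])
  finally show "primal_objective dv w lam (\<chi> l. density y l / w $ l) < primal_objective dv w lam g"
    by (simp add: z_def)
qed

context
  fixes m assumes m: "m \<in> realizable v dv \<alpha>"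
begin

lemma realizable_sum: "m = (\<Sum>l\<in>UNIV. (dv $ l * density (dual_point m) l) *\<^sub>R p l)"
  using m dual_point_moments unfolding realizable_eq by (auto simp: moments_def[symmetric])

lemma moments_dual_point_realizable: "moments p (dual_point m) = m"
  using realizable_sum by (simp add: moments_def)

lemma reconstruction_eq: "reconstruction v dv w \<alpha> lam m = (\<chi> l. density (dual_point m) l)"
  using w_pos
  by (simp add: reconstruction_def primal_solution_eq[OF moments_dual_point_realizable] vec_eq_iff
      less_imp_neq[symmetric])

lemma next_moments_eq:
  "next_moments v dv w \<alpha> \<gamma> lam m = moments (\<lambda>l. monom_vec \<gamma> (v l)) (dual_point m)"
  by (simp add: next_moments_def reconstruction_eq moment_matrix_mult_vec moments_def)

lemma gram_matrix_reconstruction: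
  "gram_matrix v dv (reconstruction v dv w \<alpha> lam m) \<gamma> \<alpha> = gram (\<lambda>l. monom_vec \<gamma> (v l)) (dual_point m)"
  by (simp add: gram_matrix_def gram_def reconstruction_eq)

text \<open>The scaled unit vectors \<open>axis l (1 / dv $ l)\<close> cancel the quadrature
  weights, so the density itself becomes a moment map.\<close>

lemma reconstruction_eq_moments:
  "reconstruction v dv w \<alpha> lam m = moments (\<lambda>l. axis l (1 / dv $ l)) (dual_point m)"
proof -
  have "(dv $ l * density y l) *\<^sub>R axis l (1 / dv $ l) = axis l (density y l)" for l y
    using dv_pos[of l] by (simp add: axis_def vec_eq_iff)
  then show ?thesis
    by (simp add: reconstruction_eq moments_def vec_eq_iff sum_component axis_def)
qed

end

lemma open_realizable: "open (realizable v dv \<alpha>)"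
  unfolding open_contains_ball
proof
  fix m assume m: "m \<in> realizable v dv \<alpha>"
  show "\<exists>r>0. ball m r \<subseteq> realizable v dv \<alpha>"
  proof (rule moments_dual_point_near[OF realizable_sum[OF m] density_pos])
    fix r assume "r > 0" and near: "\<forall>x\<in>ball m r. moments p (dual_point x) = x"
    have "ball m r \<subseteq> realizable v dv \<alpha>"
    proof
      fix x assume "x \<in> ball m r"
      with near have "moments p (dual_point x) = x" by blast
      then show "x \<in> realizable v dv \<alpha>" unfolding realizable_eq by (intro range_eqI) (rule sym)
    qed
    with \<open>r > 0\<close> show ?thesis by blast
  qed
qed

lemma moments_dual_point_real_analytic:
  "(\<lambda>x. moments q (dual_point x)) real_analytic_on realizable v dv \<alpha>"
  by (rule real_analytic_onI) (rule moments_dual_point_representable[OF realizable_sum density_pos])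

end

theorem theorem2:
  fixes v :: "'n::finite \<Rightarrow> real ^ 'd::finite"
    and dv w :: "real ^ 'n"
    and \<alpha> :: "'m::finite \<Rightarrow> nat ^ 'd"
    and \<gamma> :: "'k::finite \<Rightarrow> nat ^ 'd"
    and lam :: real
  assumes "\<And>l. dv $ l > 0"
    and "\<And>l. w $ l > 0"
    and "lam \<ge> 0"
    and "CARD('n) > CARD('m)"
    and "rank (moment_matrix v dv \<alpha>) = CARD('m)"
    and "0 \<in> range \<alpha>"
  shows "dual_solution v dv w \<alpha> lam real_analytic_on realizable v dv \<alpha> \<and>
     reconstruction v dv w \<alpha> lam real_analytic_on realizable v dv \<alpha> \<and>
     next_moments v dv w \<alpha> \<gamma> lam real_analytic_on realizable v dv \<alpha> \<and>
     (\<forall>m\<in>realizable v dv \<alpha>.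
       (dual_solution v dv w \<alpha> lam has_derivative
          (\<lambda>h. (- matrix_inv (H_matrix v dv w \<alpha> lam m)) *v h)) (at m) \<and>
       (next_moments v dv w \<alpha> \<gamma> lam has_derivative
          (\<lambda>h. (B_matrix v dv w \<alpha> \<gamma> lam m ** matrix_inv (H_matrix v dv w \<alpha> lam m)) *v h)) (at m))"
proof -
  interpret entropy_closure v dv w \<alpha> lam
    by standard (use assms in auto)
  let ?q = "\<lambda>l. monom_vec \<gamma> (v l)"
  show ?thesis
  proof (intro conjI ballI)
    show "dual_solution v dv w \<alpha> lam real_analytic_on realizable v dv \<alpha>"
      unfolding dual_solution_eq
      by (rule real_analytic_onI) (rule dual_point_representable[OF realizable_sum density_pos])
    show "reconstruction v dv w \<alpha> lam real_analytic_on realizable v dv \<alpha>"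
      by (rule real_analytic_on_cong[OF moments_dual_point_real_analytic open_realizable
            reconstruction_eq_moments[symmetric]])
    show "next_moments v dv w \<alpha> \<gamma> lam real_analytic_on realizable v dv \<alpha>"
      by (rule real_analytic_on_cong[OF moments_dual_point_real_analytic open_realizable
            next_moments_eq[symmetric]])
    fix m assume m: "m \<in> realizable v dv \<alpha>"
    note deriv = has_derivative_dual_point[OF realizable_sum[OF m] density_pos]
      has_derivative_moments_dual_point[OF realizable_sum[OF m] density_pos, of ?q]
    show "(dual_solution v dv w \<alpha> lam has_derivative
        (\<lambda>h. (- matrix_inv (H_matrix v dv w \<alpha> lam m)) *v h)) (at m)"
      using deriv(1) by (simp only: dual_solution_eq H_matrix_def gram_matrix_reconstruction[OF m])
    have "((\<lambda>x. moments ?q (dual_point x)) has_derivative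
        (\<lambda>h. (B_matrix v dv w \<alpha> \<gamma> lam m ** matrix_inv (H_matrix v dv w \<alpha> lam m)) *v h)) (at m)"
      using deriv(2) by (simp only: B_matrix_def H_matrix_def gram_matrix_reconstruction[OF m])
    \<comment> \<open>The two functions agree only on the cone, so the derivative is transferred on
      that open set.\<close>
    then show "(next_moments v dv w \<alpha> \<gamma> lam has_derivative
        (\<lambda>h. (B_matrix v dv w \<alpha> \<gamma> lam m ** matrix_inv (H_matrix v dv w \<alpha> lam m)) *v h)) (at m)"
      by (rule has_derivative_transform_within_open[OF _ open_realizable m next_moments_eq[symmetric]])
  qed
qed

end
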